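(* Let $Q=(F^0,F^1,r,s,\lambda)$ be a topological quiver and let $G$ be a (second-countable) locally compact group. (1) For every principal $G$-bundle $q:P\to F^0$ (with $P$ a second-countable locally compact Hausdorff space) together with an isomorphism of pullback $G$-bundles $\theta:s^*(P)\to r^*(P)$ over $F^1$, there exists a topological quiver $(E^0,E^1,\widetilde r,\widetilde s,\widetilde\lambda)$ with $E^0=P$ and $E^1=s^*(P)$ which carries a free and proper action of $G$; namely, the quiver $Q(P,\theta)$ constructed in the context is such a topological quiver. (2) Every topological quiver $R$ on which $G$ acts freely and properly is isomorphic, as a topological quiver, to one arising in this way, i.e. to $Q(P,\theta)$ for some topological quiver $Q=(F^0,F^1,r,s,\lambda)$, some principal $G$-bundle $q:P\to F^0$, and some isomorphism of $G$-bundles $\theta:s^*(P)\to r^*(P)$ over $F^1$.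
   Context: All spaces are locally compact Hausdorff. A topological quiver is a tuple $(E^0,E^1,r,s,\lambda)$ where $E^0,E^1$ are second-countable locally compact Hausdorff spaces, $r,s:E^1\to E^0$ are continuous, $s$ is also open, and $\lambda=\{\lambda_v\}_{v\in E^0}$ is a continuous $s$-system of measures: each $\lambda_v$ is a nonzero (positive Radon) measure on $E^1$ with $\operatorname{supp}(\lambda_v)=s^{-1}(v)$, and for every $\xi\in C_c(E^1)$ the function $v\mapsto\int_{E^1}\xi\,d\lambda_v$ is continuous on $E^0$. An isomorphism of topological quivers from $(E^0,E^1,r,s,\lambda)$ to $(D^0,D^1,r',s',\mu)$ is a pair of homeomorphisms $\varepsilon^1:E^1\to D^1$, $\varepsilon^0:E^0\to D^0$ with $r'\circ \varepsilon^1=\varepsilon^0\circ r$, $s'\circ \varepsilon^1=\varepsilon^0\circ s$, such that $\mu_{\varepsilon^0(v)}$ is the pushforward of $\lambda_v$ under $\varepsilon^1$ for all $v\in E^0$. A locally compact group $G$ acts on a topological quiver $(E^0,E^1,r,s,\lambda)$ if there are continuous (right) actions of $G$ on $E^0$ and $E^1$ for which $r$ and $s$ are $G$-equivariant and $\int\phi(e\cdot g)\,d\lambda_v(e)=\int\phi(e)\,d\lambda_{v\cdot g}(e)$ for all $\phi\in C_c(E^1)$, $v\in E^0$, $g\in G$. The action is called principal (free and proper) if the action on the vertex space $E^0$ is free and proper; then the action on $E^1$ is automatically free and proper. A principal $G$-bundle over $B$ is a continuous surjection $q:P\to B$ where $P$ carries a continuous free and proper right action of $G$ and $q$ induces a homeomorphism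 $P/G\cong B$. For a continuous map $f:X\to B$, the pullback is $f^*(P)=\{(x,p)\in X\times P: f(x)=q(p)\}$, with the $G$-action $(x,p)\cdot g=(x,p\cdot g)$ and bundle map $(x,p)\mapsto x$. An isomorphism of $G$-bundles over $F^1$ is a $G$-equivariant homeomorphism commuting with the projections to $F^1$. Construction of $Q(P,\theta)$: let $\pi_2$ denote the projection onto $P$. Put $E^0=P$, $E^1=s^*(P)=\{(e,p)\in F^1\times P: s(e)=q(p)\}$, $\widetilde s=\pi_2:s^*(P)\to P$, $\widetilde r=\pi_2\circ\theta:s^*(P)\to P$, and for $v\in P$ and $\phi\in C_c(E^1)$, $\int\phi(e,w)\,d\widetilde\lambda_v(e,w)=\int\phi(e,v)\,d\lambda_{q(v)}(e)$. The group $G$ acts by the given action on $E^0=P$ and by $(e,v)\cdot g=(e,v\cdot g)$ on $E^1$. *)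

theory Defs
  imports "HOL-Analysis.Analysis" "HOL-Algebra.Group"
begin

section \<open>Locally compact spaces and Radon measures\<close>

definition lc_Hausdorff :: "'a topology \<Rightarrow> bool" where
  "lc_Hausdorff X \<longleftrightarrow> locally_compact_space X \<and> Hausdorff_space X"

definition Cc :: "'a topology \<Rightarrow> ('a \<Rightarrow> complex) set" where
  "Cc X = {f. continuous_map X euclidean f \<and>
              compactin X (X closure_of {x \<in> topspace X. f x \<noteq> 0})}"

definition borel_of :: "'a topology \<Rightarrow> 'a measure" where
  "borel_of X = sigma (topspace X) {U. openin X U}"

definition radon_measure :: "'a topology \<Rightarrow> 'a measure \<Rightarrow> bool" where
  "radon_measure X M \<longleftrightarrow>
     space M = topspace X \<and> sets M = sets (borel_of X) \<and>
     (\<forall>K. compactin X K \<longrightarrow> emeasure M K < \<infinity>) \<and>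
     (\<forall>A \<in> sets M. emeasure M A = (INF U \<in> {U. openin X U \<and> A \<subseteq> U}. emeasure M U)) \<and>
     (\<forall>U. openin X U \<longrightarrow>
        emeasure M U = (SUP K \<in> {K. compactin X K \<and> K \<in> sets M \<and> K \<subseteq> U}. emeasure M K))"

definition measure_supp :: "'a topology \<Rightarrow> 'a measure \<Rightarrow> 'a set" where
  "measure_supp X M = {x \<in> topspace X. \<forall>U. openin X U \<and> x \<in> U \<longrightarrow> emeasure M U > 0}"

section \<open>Topological quivers\<close>

text \<open>Maps and families are total functions; only their values on the carriers
  \<open>topspace (edges Q)\<close> and \<open>topspace (verts Q)\<close> are meaningful.\<close>

record ('v, 'e) quiver =
  verts :: "'v topology"
  edges :: "'e topology"
  rng :: "'e \<Rightarrow> 'v"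
  src :: "'e \<Rightarrow> 'v"
  lam :: "'v \<Rightarrow> 'e measure"

definition topological_quiver :: "('v, 'e) quiver \<Rightarrow> bool" where
  "topological_quiver Q \<longleftrightarrow>
     lc_Hausdorff (verts Q) \<and> second_countable (verts Q) \<and>
     lc_Hausdorff (edges Q) \<and> second_countable (edges Q) \<and>
     continuous_map (edges Q) (verts Q) (rng Q) \<and>
     continuous_map (edges Q) (verts Q) (src Q) \<and>
     open_map (edges Q) (verts Q) (src Q) \<and>
     (\<forall>v \<in> topspace (verts Q).
        radon_measure (edges Q) (lam Q v) \<and>
        emeasure (lam Q v) (topspace (edges Q)) \<noteq> 0 \<and>
        measure_supp (edges Q) (lam Q v) = {e \<in> topspace (edges Q). src Q e = v}) \<and>
     (\<forall>\<xi> \<in> Cc (edges Q). continuous_map (verts Q) euclidean (\<lambda>v. LINT e|lam Q v. \<xi> e))"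

definition quiver_iso ::
  "('v, 'e) quiver \<Rightarrow> ('w, 'f) quiver \<Rightarrow> ('e \<Rightarrow> 'f) \<Rightarrow> ('v \<Rightarrow> 'w) \<Rightarrow> bool" where
  "quiver_iso Q R \<epsilon>1 \<epsilon>0 \<longleftrightarrow>
     homeomorphic_map (edges Q) (edges R) \<epsilon>1 \<and>
     homeomorphic_map (verts Q) (verts R) \<epsilon>0 \<and>
     (\<forall>e \<in> topspace (edges Q). rng R (\<epsilon>1 e) = \<epsilon>0 (rng Q e) \<and> src R (\<epsilon>1 e) = \<epsilon>0 (src Q e)) \<and>
     (\<forall>v \<in> topspace (verts Q). lam R (\<epsilon>0 v) = distr (lam Q v) (borel_of (edges R)) \<epsilon>1)"

definition isomorphic_quivers :: "('v, 'e) quiver \<Rightarrow> ('w, 'f) quiver \<Rightarrow> bool" where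
  "isomorphic_quivers Q R \<longleftrightarrow> (\<exists>\<epsilon>1 \<epsilon>0. quiver_iso Q R \<epsilon>1 \<epsilon>0)"

section \<open>Group actions\<close>

definition lc_group :: "'g monoid \<Rightarrow> 'g topology \<Rightarrow> bool" where
  "lc_group G T \<longleftrightarrow>
     group G \<and> topspace T = carrier G \<and>
     continuous_map (prod_topology T T) T (\<lambda>(g, h). g \<otimes>\<^bsub>G\<^esub> h) \<and>
     continuous_map T T (\<lambda>g. inv\<^bsub>G\<^esub> g) \<and>
     lc_Hausdorff T"

definition right_action ::
  "'g monoid \<Rightarrow> 'g topology \<Rightarrow> 'x topology \<Rightarrow> ('x \<Rightarrow> 'g \<Rightarrow> 'x) \<Rightarrow> bool" where
  "right_action G T X act \<longleftrightarrow>
     continuous_map (prod_topology X T) X (\<lambda>(x, g). act x g) \<and>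
     (\<forall>x \<in> topspace X. act x \<one>\<^bsub>G\<^esub> = x) \<and>
     (\<forall>x \<in> topspace X. \<forall>g \<in> carrier G. \<forall>h \<in> carrier G.
        act (act x g) h = act x (g \<otimes>\<^bsub>G\<^esub> h))"

definition free_action :: "'g monoid \<Rightarrow> 'x topology \<Rightarrow> ('x \<Rightarrow> 'g \<Rightarrow> 'x) \<Rightarrow> bool" where
  "free_action G X act \<longleftrightarrow>
     (\<forall>x \<in> topspace X. \<forall>g \<in> carrier G. act x g = x \<longrightarrow> g = \<one>\<^bsub>G\<^esub>)"

definition proper_action ::
  "'g topology \<Rightarrow> 'x topology \<Rightarrow> ('x \<Rightarrow> 'g \<Rightarrow> 'x) \<Rightarrow> bool" where
  "proper_action T X act \<longleftrightarrow>
     proper_map (prod_topology X T) (prod_topology X X) (\<lambda>(x, g). (x, act x g))"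

definition quiver_action ::
  "'g monoid \<Rightarrow> 'g topology \<Rightarrow> ('v, 'e) quiver \<Rightarrow>
     ('v \<Rightarrow> 'g \<Rightarrow> 'v) \<Rightarrow> ('e \<Rightarrow> 'g \<Rightarrow> 'e) \<Rightarrow> bool" where
  "quiver_action G T Q act0 act1 \<longleftrightarrow>
     right_action G T (verts Q) act0 \<and>
     right_action G T (edges Q) act1 \<and>
     (\<forall>e \<in> topspace (edges Q). \<forall>g \<in> carrier G.
        rng Q (act1 e g) = act0 (rng Q e) g \<and> src Q (act1 e g) = act0 (src Q e) g) \<and>
     (\<forall>\<phi> \<in> Cc (edges Q). \<forall>v \<in> topspace (verts Q). \<forall>g \<in> carrier G.
        (LINT e|lam Q v. \<phi> (act1 e g)) = (LINT e|lam Q (act0 v g). \<phi> e))"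

definition principal_quiver_action ::
  "'g monoid \<Rightarrow> 'g topology \<Rightarrow> ('v, 'e) quiver \<Rightarrow>
     ('v \<Rightarrow> 'g \<Rightarrow> 'v) \<Rightarrow> ('e \<Rightarrow> 'g \<Rightarrow> 'e) \<Rightarrow> bool" where
  "principal_quiver_action G T Q act0 act1 \<longleftrightarrow>
     quiver_action G T Q act0 act1 \<and>
     free_action G (verts Q) act0 \<and> proper_action T (verts Q) act0"

section \<open>Principal bundles and their pullbacks\<close>

definition orbit_of :: "'g monoid \<Rightarrow> ('x \<Rightarrow> 'g \<Rightarrow> 'x) \<Rightarrow> 'x \<Rightarrow> 'x set" where
  "orbit_of G act x = act x ` carrier G"

definition orbit_space ::
  "'g monoid \<Rightarrow> 'x topology \<Rightarrow> ('x \<Rightarrow> 'g \<Rightarrow> 'x) \<Rightarrow> 'x set topology" where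
  "orbit_space G X act =
     topology (\<lambda>U. U \<subseteq> orbit_of G act ` topspace X \<and>
                   openin X {x \<in> topspace X. orbit_of G act x \<in> U})"

lemma openin_orbit_space:
  "openin (orbit_space G X act) U \<longleftrightarrow>
     U \<subseteq> orbit_of G act ` topspace X \<and> openin X {x \<in> topspace X. orbit_of G act x \<in> U}"
proof -
  let ?P = "\<lambda>U. U \<subseteq> orbit_of G act ` topspace X \<and>
                openin X {x \<in> topspace X. orbit_of G act x \<in> U}"
  have "istopology ?P"
    unfolding istopology_def
  proof (intro conjI allI impI)
    fix S V assume "?P S" and "?P V"
    moreover have "{x \<in> topspace X. orbit_of G act x \<in> S \<inter> V} =
        {x \<in> topspace X. orbit_of G act x \<in> S} \<inter> {x \<in> topspace X. orbit_of G act x \<in> V}"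
      by blast
    ultimately show "S \<inter> V \<subseteq> orbit_of G act ` topspace X"
      and "openin X {x \<in> topspace X. orbit_of G act x \<in> S \<inter> V}"
      by (blast, simp only: openin_Int)
  next
    fix \<K> assume K: "\<forall>S\<in>\<K>. ?P S"
    have eq: "{x \<in> topspace X. orbit_of G act x \<in> \<Union>\<K>} =
        (\<Union>S\<in>\<K>. {x \<in> topspace X. orbit_of G act x \<in> S})"
      by blast
    show "\<Union>\<K> \<subseteq> orbit_of G act ` topspace X"
      using K by blast
    show "openin X {x \<in> topspace X. orbit_of G act x \<in> \<Union>\<K>}"
      unfolding eq using K by (intro openin_Union) blast
  qed
  then show ?thesis
    unfolding orbit_space_def by (simp add: topology_inverse')
qed

definition principal_bundle ::
  "'g monoid \<Rightarrow> 'g topology \<Rightarrow> 'p topology \<Rightarrow> ('p \<Rightarrow> 'g \<Rightarrow> 'p) \<Rightarrow>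
     'b topology \<Rightarrow> ('p \<Rightarrow> 'b) \<Rightarrow> bool" where
  "principal_bundle G T P act B q \<longleftrightarrow>
     lc_Hausdorff P \<and> lc_Hausdorff B \<and>
     right_action G T P act \<and> free_action G P act \<and> proper_action T P act \<and>
     continuous_map P B q \<and> q ` topspace P = topspace B \<and>
     (\<exists>h. homeomorphic_map (orbit_space G P act) B h \<and>
          (\<forall>p \<in> topspace P. h (orbit_of G act p) = q p))"

definition pullback ::
  "'x topology \<Rightarrow> ('x \<Rightarrow> 'b) \<Rightarrow> 'p topology \<Rightarrow> ('p \<Rightarrow> 'b) \<Rightarrow> ('x \<times> 'p) topology" where
  "pullback X f P q =
     subtopology (prod_topology X P) {(x, p). x \<in> topspace X \<and> p \<in> topspace P \<and> f x = q p}"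

definition pullback_act :: "('p \<Rightarrow> 'g \<Rightarrow> 'p) \<Rightarrow> 'x \<times> 'p \<Rightarrow> 'g \<Rightarrow> 'x \<times> 'p" where
  "pullback_act act z g = (fst z, act (snd z) g)"

text \<open>An isomorphism of pullback bundles \<open>f\<^sup>*(P) \<rightarrow> g\<^sup>*(P)\<close> over \<open>X\<close>.\<close>

definition pullback_bundle_iso ::
  "'g monoid \<Rightarrow> 'x topology \<Rightarrow> 'p topology \<Rightarrow> ('p \<Rightarrow> 'g \<Rightarrow> 'p) \<Rightarrow> ('p \<Rightarrow> 'b) \<Rightarrow>
     ('x \<Rightarrow> 'b) \<Rightarrow> ('x \<Rightarrow> 'b) \<Rightarrow> ('x \<times> 'p \<Rightarrow> 'x \<times> 'p) \<Rightarrow> bool" where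
  "pullback_bundle_iso G X P act q f f' \<theta> \<longleftrightarrow>
     homeomorphic_map (pullback X f P q) (pullback X f' P q) \<theta> \<and>
     (\<forall>z \<in> topspace (pullback X f P q). fst (\<theta> z) = fst z) \<and>
     (\<forall>z \<in> topspace (pullback X f P q). \<forall>g \<in> carrier G.
        \<theta> (pullback_act act z g) = pullback_act act (\<theta> z) g)"

section \<open>The quiver of a bundle isomorphism\<close>

text \<open>A test function \<open>\<phi>\<close> on \<open>s\<^sup>*(P)\<close> has meaningful values \<open>\<phi> (e, v)\<close> only for
  \<open>s e = q v\<close>. Since \<open>\<lambda> (q v)\<close> is concentrated on this fibre, the integral is taken over the
  fibre, so that arbitrary (possibly non-measurable) values off the pullback play no role.\<close>

definition fibre_integral ::
  "('v, 'e) quiver \<Rightarrow> ('p \<Rightarrow> 'v) \<Rightarrow> 'p \<Rightarrow> ('e \<times> 'p \<Rightarrow> complex) \<Rightarrow> complex" where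
  "fibre_integral Q q v \<phi> =
     (LINT e:{e \<in> topspace (edges Q). src Q e = q v}|lam Q (q v). \<phi> (e, v))"

definition bundle_lam ::
  "('v, 'e) quiver \<Rightarrow> 'p topology \<Rightarrow> ('p \<Rightarrow> 'v) \<Rightarrow> 'p \<Rightarrow> ('e \<times> 'p) measure" where
  "bundle_lam Q P q v =
     (THE \<mu>. radon_measure (pullback (edges Q) (src Q) P q) \<mu> \<and>
        (\<forall>\<phi> \<in> Cc (pullback (edges Q) (src Q) P q).
           (LINT z|\<mu>. \<phi> z) = fibre_integral Q q v \<phi>))"

definition bundle_quiver ::
  "('v, 'e) quiver \<Rightarrow> 'p topology \<Rightarrow> ('p \<Rightarrow> 'v) \<Rightarrow> ('e \<times> 'p \<Rightarrow> 'e \<times> 'p) \<Rightarrow>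
     ('p, 'e \<times> 'p) quiver" where
  "bundle_quiver Q P q \<theta> =
     \<lparr> verts = P,
       edges = pullback (edges Q) (src Q) P q,
       rng = (\<lambda>z. snd (\<theta> z)),
       src = snd,
       lam = bundle_lam Q P q \<rparr>"

end

theory Submission
  imports Defs
begin

text \<open>
  (1) The measure of \<open>Q(P,\<theta>)\<close> at \<open>v\<close> is the pushforward of \<open>\<lambda>\<close> at \<open>q v\<close>, restricted to its fibre, along the
  proper map \<open>e \<mapsto> (e, v)\<close>; a Radon measure is determined by its integrals over compactly supported
  functions, so the definite description in \<open>bundle_lam\<close> picks out this measure. Continuity
  follows by extending a test function from the closed set \<open>s\<^sup>*(P)\<close> to the product (Tietze).

  (2) By freeness and properness the group element carrying \<open>x\<close> to \<open>x g\<close> depends continuously on the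
  pair. Hence orbit spaces are Hausdorff, and for an equivariant map \<open>f\<close> from \<open>Y\<close> to \<open>X\<close> the map
  \<open>y \<mapsto> ([y], f y)\<close> is a homeomorphism from \<open>Y\<close> onto the pullback of \<open>X\<close> along \<open>Y/G \<rightarrow> X/G\<close>.
  Applied to \<open>s\<close> and \<open>r\<close> this gives \<open>\<theta>\<close> and the isomorphism. The measures descend to the quotient
  because each fibre of \<open>s\<close> embeds as a closed subset of \<open>E\<^sup>1/G\<close>.
\<close>

section \<open>Radon measures and their pushforwards\<close>

text \<open>Principal bundles are given here by free and proper actions, without local sections; in
  part (2) the continuous division map \<open>\<delta>\<close> does the work that sections would do.
  Since \<open>s\<close> and \<open>r\<close> each present the edge space as a pullback over
  \<open>E\<^sup>1/G\<close>, \<open>\<theta>\<close> is the change from one presentation to the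
  other, from \<open>([e], s e)\<close> to \<open>([e], r e)\<close>.

  The delicate point is the measures. \<open>e \<mapsto> (e, v)\<close> lands in the pullback only
  over one fibre, and the orbit map need not be proper beyond a fibre, whereas a proper map is what
  carries Radon measures to Radon measures. Hence every transport starts from a closed set of full
  measure. That a fibre has full measure is more than the support condition says and comes from
  inner regularity.

  Invariance is given only through integrals of compactly supported functions. Uniqueness of Radon
  measures turns it into an equation between \<open>\<lambda>\<close> at \<open>v g\<close> and the
  translate of \<open>\<lambda>\<close> at \<open>v\<close>. The orbit map erases the translation,
  so the measure at an orbit may be taken at any representative.\<close>

lemma lc_Hausdorff_imp_completely_regular_space:
  "lc_Hausdorff X \<Longrightarrow> completely_regular_space X"
  by (simp add: lc_Hausdorff_def locally_compact_regular_imp_completely_regular_space)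

lemma lc_Hausdorff_second_countable_imp_normal_space:
  assumes "lc_Hausdorff X" "second_countable X"
  shows "normal_space X"
  using assms
  by (simp add: lc_Hausdorff_def locally_compact_Hausdorff_imp_regular_space
      regular_Lindelof_imp_normal_space second_countable_imp_Lindelof_space)

lemma lc_Hausdorff_closed_subtopology:
  "lc_Hausdorff X \<Longrightarrow> closedin X S \<Longrightarrow> lc_Hausdorff (subtopology X S)"
  by (simp add: lc_Hausdorff_def Hausdorff_space_subtopology locally_compact_space_closed_subset)

lemma lc_Hausdorff_prod_topology:
  "lc_Hausdorff X \<Longrightarrow> lc_Hausdorff Y \<Longrightarrow> lc_Hausdorff (prod_topology X Y)"
  by (simp add: lc_Hausdorff_def Hausdorff_space_prod_topology locally_compact_space_prod_topology)

lemma second_countable_prod_topology: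
  assumes "second_countable X" "second_countable Y"
  shows "second_countable (prod_topology X Y)"
proof -
  obtain \<A> where A: "countable \<A>" "\<forall>V\<in>\<A>. openin X V"
    "\<And>U x. openin X U \<and> x \<in> U \<Longrightarrow> \<exists>V\<in>\<A>. x \<in> V \<and> V \<subseteq> U"
    using assms(1) unfolding second_countable_def by metis
  obtain \<B> where B: "countable \<B>" "\<forall>V\<in>\<B>. openin Y V"
    "\<And>U x. openin Y U \<and> x \<in> U \<Longrightarrow> \<exists>V\<in>\<B>. x \<in> V \<and> V \<subseteq> U"
    using assms(2) unfolding second_countable_def by metis
  show ?thesis
    unfolding second_countable_def
  proof (intro exI conjI allI impI)
    show "countable ((\<lambda>(V, W). V \<times> W) ` (\<A> \<times> \<B>))"
      using A(1) B(1) by simp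
    show "\<forall>V\<in>(\<lambda>(V, W). V \<times> W) ` (\<A> \<times> \<B>). openin (prod_topology X Y) V"
      using A(2) B(2) by (auto simp: openin_prod_Times_iff)
    fix U z assume "openin (prod_topology X Y) U \<and> z \<in> U"
    then obtain V W where "openin X V" "openin Y W" "z \<in> V \<times> W" "V \<times> W \<subseteq> U"
      by (metis openin_prod_topology_alt prod.collapse mem_Sigma_iff)
    moreover then obtain V' W' where "V' \<in> \<A>" "fst z \<in> V'" "V' \<subseteq> V" "W' \<in> \<B>" "snd z \<in> W'" "W' \<subseteq> W"
      using A(3)[of V "fst z"] B(3)[of W "snd z"] by (metis mem_Times_iff)
    ultimately show "\<exists>V\<in>(\<lambda>(V, W). V \<times> W) ` (\<A> \<times> \<B>). z \<in> V \<and> V \<subseteq> U"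
      by (intro bexI[of _ "V' \<times> W'"]) (auto simp: mem_Times_iff)
  qed
qed

section \<open>Functions of compact support and cutoffs\<close>

text \<open>The support in \<open>Cc\<close> is a closure; a compact set off which \<open>f\<close>
  vanishes is closed in a Hausdorff space, so it contains that closure.\<close>

lemma CcI:
  assumes "Hausdorff_space X" "continuous_map X euclidean f" "compactin X C"
    and "\<And>x. x \<in> topspace X \<Longrightarrow> x \<notin> C \<Longrightarrow> f x = 0"
  shows "f \<in> Cc X"
proof -
  have "X closure_of {x \<in> topspace X. f x \<noteq> 0} \<subseteq> C"
    using assms by (intro closure_of_minimal) (auto simp: compactin_imp_closedin)
  then show ?thesis
    using assms unfolding Cc_def by (auto intro: closed_compactin)
qed

lemma CcE:
  assumes "f \<in> Cc X"
  obtains C where "compactin X C" "\<And>x. x \<in> topspace X \<Longrightarrow> x \<notin> C \<Longrightarrow> f x = 0"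
proof
  show "compactin X (X closure_of {x \<in> topspace X. f x \<noteq> 0})"
    using assms by (simp add: Cc_def)
  show "f x = 0" if "x \<in> topspace X" "x \<notin> X closure_of {x \<in> topspace X. f x \<noteq> 0}" for x
    using that closure_of_subset[of "{x \<in> topspace X. f x \<noteq> 0}" X] by blast
qed

lemma Cc_continuous_map: "f \<in> Cc X \<Longrightarrow> continuous_map X euclidean f"
  by (simp add: Cc_def)

text \<open>Local compactness puts \<open>K\<close> inside an open \<open>V\<close> contained in a
  compact \<open>L\<close>. Asking the Urysohn function to vanish off \<open>U \<inter> V\<close>,
  and not merely off \<open>U\<close>, is what makes its support compact.\<close>

lemma Cc_Urysohn:
  assumes X: "lc_Hausdorff X" and K: "compactin X K" and U: "openin X U" "K \<subseteq> U"
  obtains f :: "'a \<Rightarrow> real" where "continuous_map X euclidean f" "\<And>x. 0 \<le> f x" "\<And>x. f x \<le> 1"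
    "\<And>x. x \<in> K \<Longrightarrow> f x = 1" "\<And>x. x \<notin> U \<Longrightarrow> f x = 0" "(\<lambda>x. complex_of_real (f x)) \<in> Cc X"
proof -
  obtain V L where V: "openin X V" "compactin X L" "K \<subseteq> V" "V \<subseteq> L"
    using X K by (metis lc_Hausdorff_def locally_compact_space_compact_closed_compact)
  obtain g where g: "continuous_map X (top_of_set {0..1::real}) g" "g ` (topspace X - U \<inter> V) \<subseteq> {0}" "g ` K \<subseteq> {1}"
  proof (rule Urysohn_completely_regular_compact_closed[of 0 1])
    show "completely_regular_space X"
      by (rule lc_Hausdorff_imp_completely_regular_space[OF X])
    show "disjnt K (topspace X - U \<inter> V)"
      using U V by (auto simp: disjnt_iff)
  qed (use K U V in auto)
  \<comment> \<open>Extension by zero off the carrier makes the bounds and the vanishing off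
    \<open>U\<close> hold at every point of the type.\<close>
  define f where "f x = (if x \<in> topspace X then g x else 0)" for x
  have f: "continuous_map X euclideanreal f"
    by (rule continuous_map_eq[of _ _ g]) (use g(1) in \<open>auto simp: f_def continuous_map_in_subtopology\<close>)
  have g01: "g x \<in> {0..1}" if "x \<in> topspace X" for x
    using g(1) that by (auto simp: continuous_map_in_subtopology image_subset_iff Pi_iff)
  have f01: "0 \<le> f x" "f x \<le> 1" for x
    using g01[of x] by (auto simp: f_def)
  have f0: "f x = 0" if "x \<notin> U \<inter> V" for x
    using g(2) that by (auto simp: f_def)
  show thesis
  proof
    show "(\<lambda>x. complex_of_real (f x)) \<in> Cc X"
    proof (rule CcI[where C = L])
      show "continuous_map X euclidean (\<lambda>x. complex_of_real (f x))"
        using continuous_map_compose[OF f, of euclidean complex_of_real] by (simp add: o_def continuous_on_of_real_id)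
    qed (use X V f0 in \<open>auto simp: lc_Hausdorff_def\<close>)
    show "f x = 1" if "x \<in> K" for x
      using that g(3) compactin_subset_topspace[OF K] by (auto simp: f_def)
  qed (use f f0 f01 in auto)
qed

section \<open>Borel sets and uniqueness of Radon measures\<close>

lemma space_borel_of [simp]: "space (borel_of X) = topspace X"
  by (simp add: borel_of_def space_measure_of_conv)

lemma sets_borel_of: "sets (borel_of X) = sigma_sets (topspace X) {U. openin X U}"
  unfolding borel_of_def by (rule sets_measure_of) (auto dest: openin_subset)

lemma open_in_sets_borel_of: "openin X U \<Longrightarrow> U \<in> sets (borel_of X)"
  by (simp add: sets_borel_of sigma_sets.Basic)

lemma closed_in_sets_borel_of: "closedin X C \<Longrightarrow> C \<in> sets (borel_of X)"
  by (metis closedin_def double_diff openin_subset order_refl sets.compl_sets space_borel_of open_in_sets_borel_of)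

lemma measurable_borel_ofI:
  assumes "f \<in> space M \<rightarrow> topspace Y"
    and "\<And>U. openin Y U \<Longrightarrow> f -` U \<inter> space M \<in> sets M"
  shows "f \<in> measurable M (borel_of Y)"
  unfolding borel_of_def using assms
  by (intro measurable_measure_of) (auto dest: openin_subset)

lemma continuous_map_measurable_restrict_space:
  assumes "sets M = sets (borel_of X)" "closedin X C" "continuous_map (subtopology X C) Y f"
  shows "f \<in> measurable (restrict_space M C) (borel_of Y)"
proof (rule measurable_borel_ofI)
  have sp: "space M = topspace X" using sets_eq_imp_space_eq[OF assms(1)] by simp
  have C: "C \<subseteq> topspace X" using assms(2) by (rule closedin_subset)
  then have spr: "space (restrict_space M C) = C" by (auto simp: space_restrict_space sp)
  show "f \<in> space (restrict_space M C) \<rightarrow> topspace Y"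
    using continuous_map_image_subset_topspace[OF assms(3)] C by (auto simp: spr)
  fix U assume "openin Y U"
  then obtain W where W: "openin X W" "{x \<in> topspace (subtopology X C). f x \<in> U} = W \<inter> C"
    using openin_continuous_map_preimage[OF assms(3)] by (metis openin_subtopology)
  then have "f -` U \<inter> space (restrict_space M C) = W \<inter> C"
    using C by (auto simp: spr)
  then show "f -` U \<inter> space (restrict_space M C) \<in> sets (restrict_space M C)"
    using W assms(1,2) C by (auto simp: sets_restrict_space_iff sp Int_absorb2 open_in_sets_borel_of closed_in_sets_borel_of)
qed

lemma continuous_map_measurable_borel_of:
  assumes "sets M = sets (borel_of X)" "continuous_map X Y f"
  shows "f \<in> measurable M (borel_of Y)"
proof (rule measurable_borel_ofI)
  have sp: "space M = topspace X" using sets_eq_imp_space_eq[OF assms(1)] by simp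
  show "f \<in> space M \<rightarrow> topspace Y"
    using continuous_map_image_subset_topspace[OF assms(2)] by (auto simp: sp)
  fix U assume "openin Y U"
  then have "openin X {x \<in> topspace X. f x \<in> U}"
    using assms(2) by (rule openin_continuous_map_preimage[rotated])
  moreover have "{x \<in> topspace X. f x \<in> U} = f -` U \<inter> space M" by (auto simp: sp)
  ultimately show "f -` U \<inter> space M \<in> sets M"
    using assms(1) by (simp add: open_in_sets_borel_of)
qed

lemma sets_borel_of_euclidean: "sets (borel_of euclidean) = sets borel"
  by (simp add: borel_of_def borel_def)

lemma continuous_map_borel_measurable:
  assumes "sets M = sets (borel_of X)" "continuous_map X euclidean f"
  shows "f \<in> borel_measurable M"
  using continuous_map_measurable_borel_of[OF assms] measurable_cong_sets[OF refl sets_borel_of_euclidean] by blast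

lemma radon_measureD:
  assumes "radon_measure X M"
  shows "space M = topspace X" "sets M = sets (borel_of X)"
    and "compactin X K \<Longrightarrow> emeasure M K < \<infinity>"
    and "A \<in> sets M \<Longrightarrow> emeasure M A = (INF U \<in> {U. openin X U \<and> A \<subseteq> U}. emeasure M U)"
    and "openin X U \<Longrightarrow> emeasure M U = (SUP K \<in> {K. compactin X K \<and> K \<in> sets M \<and> K \<subseteq> U}. emeasure M K)"
  using assms unfolding radon_measure_def by blast+

lemma Cc_bounded:
  assumes "f \<in> Cc X"
  obtains B where "0 \<le> B" "\<And>x. x \<in> topspace X \<Longrightarrow> norm (f x) \<le> B"
proof -
  obtain C where C: "compactin X C" "\<And>x. x \<in> topspace X \<Longrightarrow> x \<notin> C \<Longrightarrow> f x = 0"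
    using CcE[OF assms] by metis
  have "compact (f ` C)"
    using image_compactin[OF C(1) Cc_continuous_map[OF assms]] by simp
  then obtain B where B: "\<forall>y\<in>f ` C. norm y \<le> B"
    using compact_imp_bounded bounded_iff by metis
  show thesis
  proof
    show "norm (f x) \<le> max B 0" if "x \<in> topspace X" for x
      using B C(2)[OF that] by (cases "x \<in> C") (auto simp: le_max_iff_disj)
  qed simp
qed

lemma integrable_Cc:
  assumes "Hausdorff_space X" "radon_measure X M" "f \<in> Cc X"
  shows "integrable M f"
proof -
  note M = radon_measureD[OF assms(2)]
  obtain C where C: "compactin X C" "\<And>x. x \<in> topspace X \<Longrightarrow> x \<notin> C \<Longrightarrow> f x = 0"
    using CcE[OF assms(3)] by metis
  obtain B where B: "\<And>x. x \<in> topspace X \<Longrightarrow> norm (f x) \<le> B"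
    using Cc_bounded[OF assms(3)] by metis
  show ?thesis
  proof (rule integrableI_bounded_set[where A = C and B = B])
    show "C \<in> sets M"
      using assms(1) C(1) by (simp add: M(2) closed_in_sets_borel_of compactin_imp_closedin)
    show "f \<in> borel_measurable M"
      using continuous_map_borel_measurable[OF M(2) Cc_continuous_map[OF assms(3)]] .
    show "emeasure M C < \<infinity>"
      using M(3)[OF C(1)] .
  qed (use B C M(1) in auto)
qed

text \<open>A cutoff between the indicators of \<open>K\<close> and of an open \<open>U\<close>
  around it has the same integral for both measures, so \<open>M\<close> of \<open>K\<close> is at
  most \<open>N\<close> of \<open>U\<close>; outer regularity of \<open>N\<close> then shrinks
  \<open>U\<close> to \<open>K\<close>. The one-sided form yields equality by exchanging the
  measures.\<close>

lemma radon_measure_le_on_compact: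
  assumes X: "lc_Hausdorff X" and M: "radon_measure X M" and N: "radon_measure X N"
    and eq: "\<And>f. f \<in> Cc X \<Longrightarrow> (LINT x|M. f x) = (LINT x|N. f x)"
    and K: "compactin X K"
  shows "emeasure M K \<le> emeasure N K"
proof -
  note M' = radon_measureD[OF M] and N' = radon_measureD[OF N]
  have H: "Hausdorff_space X" using X by (simp add: lc_Hausdorff_def)
  have K_sets: "K \<in> sets N" "K \<in> sets M"
    using H K by (simp_all add: M'(2) N'(2) closed_in_sets_borel_of compactin_imp_closedin)
  have "emeasure M K \<le> emeasure N U" if U: "openin X U" "K \<subseteq> U" for U
  proof -
    obtain f :: "'a \<Rightarrow> real" where f: "continuous_map X euclidean f" "\<And>x. 0 \<le> f x" "\<And>x. f x \<le> 1"
      "\<And>x. x \<in> K \<Longrightarrow> f x = 1" "\<And>x. x \<notin> U \<Longrightarrow> f x = 0" "(\<lambda>x. complex_of_real (f x)) \<in> Cc X"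
      using Cc_Urysohn[OF X K U] by blast
    have fi: "integrable M f" "integrable N f"
      using integrable_Cc[OF H M f(6)] integrable_Cc[OF H N f(6)] by (simp_all add: complex_of_real_integrable_eq)
    have fe: "integral\<^sup>L M f = integral\<^sup>L N f"
      using eq[OF f(6)] by simp
    have "emeasure M K = (\<integral>\<^sup>+x. indicator K x \<partial>M)"
      using K_sets by simp
    also have "\<dots> \<le> (\<integral>\<^sup>+x. f x \<partial>M)"
      using f by (intro nn_integral_mono) (auto simp: indicator_def)
    also have "\<dots> = (\<integral>\<^sup>+x. f x \<partial>N)"
      using f(2) fi fe by (simp add: nn_integral_eq_integral)
    also have "\<dots> \<le> (\<integral>\<^sup>+x. indicator U x \<partial>N)"
      using f by (intro nn_integral_mono) (auto simp: indicator_def)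
    also have "\<dots> = emeasure N U"
      using U(1) by (simp add: N'(2) open_in_sets_borel_of)
    finally show ?thesis .
  qed
  then show ?thesis
    unfolding N'(4)[OF K_sets(1)] by (intro INF_greatest) auto
qed

text \<open>Agreement spreads from compact sets to open sets by inner regularity, and from open sets
  to all Borel sets by outer regularity.\<close>

lemma radon_measure_eqI:
  assumes X: "lc_Hausdorff X" and M: "radon_measure X M" and N: "radon_measure X N"
    and eq: "\<And>f. f \<in> Cc X \<Longrightarrow> (LINT x|M. f x) = (LINT x|N. f x)"
  shows "M = N"
proof -
  note M' = radon_measureD[OF M] and N' = radon_measureD[OF N]
  have K: "emeasure M K = emeasure N K" if "compactin X K" for K
    using radon_measure_le_on_compact[OF X M N eq that] radon_measure_le_on_compact[OF X N M eq[symmetric] that]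
    by (rule antisym)
  have U: "emeasure M U = emeasure N U" if "openin X U" for U
    unfolding M'(5)[OF that] N'(5)[OF that] M'(2) N'(2) by (intro SUP_cong) (auto simp: K)
  show ?thesis
  proof (rule measure_eqI)
    show "sets M = sets N" by (simp add: M'(2) N'(2))
    fix A assume "A \<in> sets M"
    then show "emeasure M A = emeasure N A"
      using M'(4)[of A] N'(4)[of A] by (auto simp: M'(2) N'(2) U intro!: INF_cong)
  qed
qed

text \<open>Each point off the support has a null open neighbourhood, but their union is uncountable
  in general. A compact subset of the complement needs only finitely many of them, and inner
  regularity on the open complement finishes.\<close>

lemma radon_measure_null_off_supp:
  assumes X: "Hausdorff_space X" and M: "radon_measure X M" and C: "closedin X C" "measure_supp X M = C"
  shows "emeasure M (topspace X - C) = 0"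
proof -
  note M' = radon_measureD[OF M]
  have "emeasure M K = 0" if K: "compactin X K" "K \<subseteq> topspace X - C" "K \<in> sets M" for K
  proof -
    have "\<forall>x\<in>K. \<exists>U. openin X U \<and> x \<in> U \<and> emeasure M U = 0"
      using K(2) C(2) unfolding measure_supp_def by (smt (verit) DiffD1 DiffD2 mem_Collect_eq not_gr_zero subsetD)
    then obtain U where U: "\<And>x. x \<in> K \<Longrightarrow> openin X (U x) \<and> x \<in> U x \<and> emeasure M (U x) = 0"
      by metis
    then obtain D where D: "finite D" "D \<subseteq> K" "K \<subseteq> (\<Union>x\<in>D. U x)"
      using compactinD[OF K(1), of "U ` K"] by (metis (no_types, lifting) UN_I finite_subset_image imageE subsetI)
    have "U x \<in> null_sets M" if "x \<in> D" for x
      using U[of x] D(2) that by (auto simp: null_sets_def M'(2) open_in_sets_borel_of)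
    then have "(\<Union>x\<in>D. U x) \<in> null_sets M"
      using D(1) by (intro null_sets.finite_UN) auto
    with D(3) K(3) show ?thesis
      by (meson null_sets_subset null_setsD1)
  qed
  then have "(SUP K \<in> {K. compactin X K \<and> K \<in> sets M \<and> K \<subseteq> topspace X - C}. emeasure M K) \<le> 0"
    by (intro SUP_least) auto
  moreover have "openin X (topspace X - C)" using C(1) by blast
  ultimately show ?thesis
    by (simp add: M'(5))
qed


section \<open>Pushing Radon measures along maps that are proper on a closed set of full
  measure\<close>

text \<open>Restriction comes before the image measure because \<open>i\<close> may fail to be
  continuous, or leave \<open>Y\<close> altogether, at points off \<open>C\<close>.\<close>

definition pushforward :: "'x measure \<Rightarrow> 'x set \<Rightarrow> 'y topology \<Rightarrow> ('x \<Rightarrow> 'y) \<Rightarrow> 'y measure" where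
  "pushforward M C Y i = distr (restrict_space M C) (borel_of Y) i"

lemma sets_pushforward [simp]: "sets (pushforward M C Y i) = sets (borel_of Y)"
  by (simp add: pushforward_def)

lemma space_pushforward [simp]: "space (pushforward M C Y i) = topspace Y"
  by (simp add: pushforward_def)

text \<open>The setting shared by all transports of measures: a fibre embedded into the pullback by
  \<open>e \<mapsto> (e, v)\<close>, a fibre mapped to the orbit space, and translation by a group
  element, where \<open>C\<close> is the whole carrier.\<close>

locale radon_pushforward =
  fixes X :: "'x topology" and M :: "'x measure" and C :: "'x set"
    and Y :: "'y topology" and i :: "'x \<Rightarrow> 'y"
  assumes X: "Hausdorff_space X" and Y: "Hausdorff_space Y"
    and M: "radon_measure X M"
    and C: "closedin X C" and null: "emeasure M (topspace X - C) = 0"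
    and cont: "continuous_map (subtopology X C) Y i"
    and proper: "proper_map (subtopology X C) Y i"
begin

lemma topspace_C: "topspace (subtopology X C) = C"
  using closedin_subset[OF C] by auto

lemma sets_M: "sets M = sets (borel_of X)" and space_M: "space M = topspace X"
  using radon_measureD[OF M] by auto

lemma C_sets: "C \<in> sets M"
  using C by (simp add: sets_M closed_in_sets_borel_of)

lemma space_restrict: "space (restrict_space M C) = C"
  using closedin_subset[OF C] by (auto simp: space_restrict_space space_M)

lemma measurable: "i \<in> measurable (restrict_space M C) (borel_of Y)"
  using continuous_map_measurable_restrict_space[OF sets_M C cont] .

lemma vimage_sets:
  assumes "A \<in> sets (borel_of Y)"
  shows "{x \<in> C. i x \<in> A} \<in> sets M"
proof -
  have "i -` A \<inter> space (restrict_space M C) \<in> sets (restrict_space M C)"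
    using measurable_sets[OF measurable assms] .
  moreover have "i -` A \<inter> space (restrict_space M C) = {x \<in> C. i x \<in> A}"
    by (auto simp: space_restrict)
  ultimately show ?thesis
    using C_sets by (auto simp: sets_restrict_space_iff)
qed

lemma emeasure_eq:
  assumes "A \<in> sets (borel_of Y)"
  shows "emeasure (pushforward M C Y i) A = emeasure M {x \<in> C. i x \<in> A}"
proof -
  have "emeasure (pushforward M C Y i) A = emeasure (restrict_space M C) (i -` A \<inter> C)"
    unfolding pushforward_def by (subst emeasure_distr[OF measurable assms]) (simp add: space_restrict)
  also have "\<dots> = emeasure M (i -` A \<inter> C)"
    using C_sets by (intro emeasure_restrict_space) auto
  also have "i -` A \<inter> C = {x \<in> C. i x \<in> A}" by auto
  finally show ?thesis .
qed

lemma AE_in_C: "AE x in M. x \<in> C"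
proof -
  have "openin X (topspace X - C)" using C by blast
  then have "AE x in M. x \<notin> topspace X - C"
    using null by (intro AE_not_in) (simp add: null_sets_def sets_M open_in_sets_borel_of)
  then show ?thesis
    using AE_space by eventually_elim (auto simp: space_M)
qed

lemma emeasure_Int_C:
  assumes "A \<in> sets M"
  shows "emeasure M (A \<inter> C) = emeasure M A"
proof (rule emeasure_eq_AE)
  show "AE x in M. x \<in> A \<inter> C \<longleftrightarrow> x \<in> A"
    using AE_in_C by eventually_elim auto
qed (use assms C_sets in auto)

lemma integral_eq:
  fixes f :: "'y \<Rightarrow> 'b::{banach, second_countable_topology}"
  assumes "f \<in> borel_measurable (borel_of Y)"
  shows "(LINT y|pushforward M C Y i. f y) = (LINT x:C|M. f (i x))"
  unfolding pushforward_def set_lebesgue_integral_def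
  using C_sets by (simp add: integral_distr[OF measurable assms] integral_restrict_space)

lemma set_integral_C:
  fixes f :: "'x \<Rightarrow> 'b::{banach, second_countable_topology}"
  assumes "f \<in> borel_measurable M"
  shows "(LINT x:C|M. f x) = (LINT x|M. f x)"
  unfolding set_lebesgue_integral_def
proof (rule integral_cong_AE)
  show "AE x in M. indicat_real C x *\<^sub>R f x = f x"
    using AE_in_C by eventually_elim simp
qed (use assms C_sets in measurable)

lemma closed_image: "closedin X D \<Longrightarrow> D \<subseteq> C \<Longrightarrow> closedin Y (i ` D)"
  using proper_imp_closed_map[OF proper] C unfolding closed_map_def
  by (metis closedin_subset_topspace topspace_C closedin_closed_subtopology)

lemma openin_vimage:
  assumes "openin Y U"
  obtains W where "openin X W" "{x \<in> C. i x \<in> U} = W \<inter> C"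
  using openin_continuous_map_preimage[OF cont assms] by (metis openin_subtopology topspace_C)

lemma image_subset: "i ` C \<subseteq> topspace Y"
  using continuous_map_image_subset_topspace[OF cont] unfolding topspace_C .

text \<open>Properness is used in two ways: preimages of compact sets are compact, which gives
  finiteness on compact sets, and \<open>i\<close> is closed, which gives outer regularity. Inner
  regularity needs only continuity, since images of compact sets are compact.\<close>

lemma radon: "radon_measure Y (pushforward M C Y i)"
  unfolding radon_measure_def
proof (intro conjI allI impI ballI)
  fix K assume K: "compactin Y K"
  have "compactin (subtopology X C) {x \<in> topspace (subtopology X C). i x \<in> K}"
    using compactin_proper_map_preimage[OF proper K] .
  then have "compactin X {x \<in> C. i x \<in> K}"
    unfolding topspace_C by (simp add: compactin_subtopology)
  then show "emeasure (pushforward M C Y i) K < \<infinity>"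
    using K Y radon_measureD(3)[OF M, of "{x \<in> C. i x \<in> K}"]
    by (simp add: emeasure_eq closed_in_sets_borel_of compactin_imp_closedin)
next
  fix A assume A: "A \<in> sets (pushforward M C Y i)"
  then have A': "A \<in> sets (borel_of Y)" by simp
  let ?N = "pushforward M C Y i"
  show "emeasure ?N A = (INF U\<in>{U. openin Y U \<and> A \<subseteq> U}. emeasure ?N U)"
  proof (rule antisym)
    show "emeasure ?N A \<le> (INF U\<in>{U. openin Y U \<and> A \<subseteq> U}. emeasure ?N U)"
      by (intro INF_greatest emeasure_mono) (auto simp: open_in_sets_borel_of)
    have "(INF U\<in>{U. openin Y U \<and> A \<subseteq> U}. emeasure ?N U) \<le> emeasure M U"
      if U: "openin X U" "{x \<in> C. i x \<in> A} \<subseteq> U" for U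
    proof -
      \<comment> \<open>This is the largest subset of \<open>Y\<close> whose preimage in
        \<open>C\<close> lies in \<open>U\<close>; it is open because \<open>i\<close> is a closed
        map.\<close>
      let ?W = "topspace Y - i ` (C - U)"
      have W: "openin Y ?W"
        using C U(1) by (intro openin_diff openin_topspace closed_image closedin_diff) auto
      have "A \<subseteq> ?W"
        using U(2) sets.sets_into_space[OF A'] by auto
      then have "(INF U\<in>{U. openin Y U \<and> A \<subseteq> U}. emeasure ?N U) \<le> emeasure ?N ?W"
        using W by (intro INF_lower) auto
      also have "\<dots> = emeasure M {x \<in> C. i x \<in> ?W}"
        using W by (intro emeasure_eq open_in_sets_borel_of)
      also have "\<dots> \<le> emeasure M U"
        using U(1) by (intro emeasure_mono) (auto simp: sets_M open_in_sets_borel_of)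
      finally show ?thesis .
    qed
    then have "(INF U\<in>{U. openin Y U \<and> A \<subseteq> U}. emeasure ?N U)
        \<le> (INF U\<in>{U. openin X U \<and> {x \<in> C. i x \<in> A} \<subseteq> U}. emeasure M U)"
      by (intro INF_greatest) auto
    also have "\<dots> = emeasure ?N A"
      using radon_measureD(4)[OF M vimage_sets[OF A']] by (simp add: emeasure_eq[OF A'])
    finally show "(INF U\<in>{U. openin Y U \<and> A \<subseteq> U}. emeasure ?N U) \<le> emeasure ?N A" .
  qed
next
  fix U assume U: "openin Y U"
  let ?N = "pushforward M C Y i"
  let ?KK = "{K. compactin Y K \<and> K \<in> sets ?N \<and> K \<subseteq> U}"
  show "emeasure ?N U = (SUP K\<in>?KK. emeasure ?N K)"
  proof (rule antisym)
    show "(SUP K\<in>?KK. emeasure ?N K) \<le> emeasure ?N U"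
      using U by (intro SUP_least emeasure_mono) (auto simp: open_in_sets_borel_of)
    \<comment> \<open>The preimage of \<open>U\<close> is open only relative to \<open>C\<close>,
      while inner regularity of \<open>M\<close> speaks of open sets of \<open>X\<close>. Replacing
      it by \<open>W\<close> changes no measure, because \<open>C\<close> has full measure.\<close>
    obtain W where W: "openin X W" "{x \<in> C. i x \<in> U} = W \<inter> C"
      using openin_vimage[OF U] .
    have "emeasure M K \<le> (SUP K\<in>?KK. emeasure ?N K)"
      if K: "compactin X K" "K \<in> sets M" "K \<subseteq> W" for K
    proof -
      have "compactin (subtopology X C) (C \<inter> K)"
        using K(1) C by (simp add: compactin_subtopology closed_Int_compactin)
      then have cK: "compactin Y (i ` (C \<inter> K))"
        using image_compactin cont by blast
      then have sK: "i ` (C \<inter> K) \<in> sets (borel_of Y)"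
        using Y by (simp add: closed_in_sets_borel_of compactin_imp_closedin)
      have "emeasure M K = emeasure M (K \<inter> C)"
        using K(2) by (simp add: emeasure_Int_C)
      also have "\<dots> \<le> emeasure M {x \<in> C. i x \<in> i ` (C \<inter> K)}"
        using vimage_sets[OF sK] by (intro emeasure_mono) auto
      also have "\<dots> = emeasure ?N (i ` (C \<inter> K))"
        using sK by (simp add: emeasure_eq)
      also have "\<dots> \<le> (SUP K\<in>?KK. emeasure ?N K)"
        using cK sK K(3) W(2) by (intro SUP_upper) auto
      finally show ?thesis .
    qed
    then have "emeasure M W \<le> (SUP K\<in>?KK. emeasure ?N K)"
      unfolding radon_measureD(5)[OF M W(1)] by (intro SUP_least) auto
    then show "emeasure ?N U \<le> (SUP K\<in>?KK. emeasure ?N K)"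
      using U W by (simp add: emeasure_eq open_in_sets_borel_of emeasure_Int_C sets_M)
  qed
qed simp_all

lemma emeasure_topspace: "emeasure (pushforward M C Y i) (topspace Y) = emeasure M (topspace X)"
proof -
  have "{x \<in> C. i x \<in> topspace Y} = topspace X \<inter> C"
    using image_subset closedin_subset[OF C] by auto
  then show ?thesis
    by (simp add: emeasure_eq open_in_sets_borel_of emeasure_Int_C sets_M)
qed

text \<open>The image of \<open>C\<close> is closed, so its complement is an open set with empty
  preimage and carries no mass. Conversely, an open neighbourhood of \<open>i x\<close> pulls back
  to the trace on \<open>C\<close> of an open neighbourhood of \<open>x\<close>, which has positive
  mass.\<close>

lemma measure_supp_eq:
  assumes supp: "measure_supp X M = C"
  shows "measure_supp Y (pushforward M C Y i) = i ` C"
proof (rule Set.set_eqI)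
  fix y
  show "y \<in> measure_supp Y (pushforward M C Y i) \<longleftrightarrow> y \<in> i ` C"
  proof
    assume y: "y \<in> measure_supp Y (pushforward M C Y i)"
    show "y \<in> i ` C"
    proof (rule ccontr)
      assume "y \<notin> i ` C"
      moreover have W: "openin Y (topspace Y - i ` C)"
        using C by (intro openin_diff openin_topspace closed_image) auto
      ultimately have "emeasure (pushforward M C Y i) (topspace Y - i ` C) > 0"
        using y by (auto simp: measure_supp_def)
      moreover have empty: "{x \<in> C. i x \<in> topspace Y - i ` C} = {}" by auto
      ultimately show False
        unfolding emeasure_eq[OF open_in_sets_borel_of[OF W]] empty by simp
    qed
  next
    assume "y \<in> i ` C"
    then obtain x where x: "x \<in> C" "y = i x" by auto
    have "emeasure (pushforward M C Y i) U > 0" if U: "openin Y U" "y \<in> U" for U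
    proof -
      obtain W where W: "openin X W" "{x \<in> C. i x \<in> U} = W \<inter> C"
        using openin_vimage[OF U(1)] .
      then have "emeasure M W > 0"
        using supp x U(2) by (force simp: measure_supp_def)
      then show ?thesis
        using U W by (simp add: emeasure_eq open_in_sets_borel_of emeasure_Int_C sets_M)
    qed
    then show "y \<in> measure_supp Y (pushforward M C Y i)"
      using x image_subset by (auto simp: measure_supp_def)
  qed
qed

text \<open>If \<open>i\<close> is continuous everywhere, what it does off \<open>C\<close> concerns
  a null set only. This allows the quotient measure to be written without mentioning a
  fibre.\<close>

lemma pushforward_eq_distr:
  assumes "continuous_map X Y i"
  shows "pushforward M C Y i = distr M (borel_of Y) i"
proof (rule measure_eqI)
  fix A assume "A \<in> sets (pushforward M C Y i)"
  then have A: "A \<in> sets (borel_of Y)" by simp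
  have i: "i \<in> measurable M (borel_of Y)"
    using continuous_map_measurable_borel_of[OF sets_M assms] .
  have "{x \<in> C. i x \<in> A} = (i -` A \<inter> space M) \<inter> C"
    using closedin_subset[OF C] by (auto simp: space_M)
  then show "emeasure (pushforward M C Y i) A = emeasure (distr M (borel_of Y) i) A"
    using A i by (simp add: emeasure_eq emeasure_distr emeasure_Int_C measurable_sets)
qed simp

end

section \<open>Continuity of integrals and pullbacks\<close>

lemma Tietze_extension_complex:
  fixes f :: "'a \<Rightarrow> complex"
  assumes X: "normal_space X" and S: "closedin X S" and f: "continuous_map (subtopology X S) euclidean f"
  obtains g where "continuous_map X euclidean g" "\<And>x. x \<in> S \<Longrightarrow> g x = f x"
proof -
  have cont: "continuous_on UNIV Re" "continuous_on UNIV Im" "continuous_on UNIV complex_of_real"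
      "continuous_on UNIV (\<lambda>x. \<i> * complex_of_real x)"
    by (intro continuous_intros)+
  have re: "continuous_map (subtopology X S) euclideanreal (Re \<circ> f)"
    and im: "continuous_map (subtopology X S) euclideanreal (Im \<circ> f)"
    by (intro continuous_map_compose[OF f]; use cont in simp)+
  obtain u where u: "continuous_map X euclideanreal u" "\<And>x. x \<in> S \<Longrightarrow> u x = Re (f x)"
    using Tietze_extension_realinterval[OF X S is_interval_univ UNIV_not_empty re subset_UNIV] by auto
  obtain v where v: "continuous_map X euclideanreal v" "\<And>x. x \<in> S \<Longrightarrow> v x = Im (f x)"
    using Tietze_extension_realinterval[OF X S is_interval_univ UNIV_not_empty im subset_UNIV] by auto
  have "continuous_map X euclidean (complex_of_real \<circ> u)"
    "continuous_map X euclidean ((\<lambda>x. \<i> * complex_of_real x) \<circ> v)"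
    by (intro continuous_map_compose[OF u(1)] continuous_map_compose[OF v(1)]; use cont in simp)+
  then have "continuous_map X euclidean (\<lambda>x. Complex (u x) (v x))"
    unfolding Complex_eq o_def by (rule continuous_map_add)
  then show thesis
    by (rule that) (simp add: u v)
qed

lemma continuous_map_euclidean_iff:
  fixes f :: "'a \<Rightarrow> 'b::metric_space"
  shows "continuous_map X euclidean f \<longleftrightarrow>
    (\<forall>x \<in> topspace X. \<forall>\<epsilon>>0. \<exists>U. openin X U \<and> x \<in> U \<and> (\<forall>y\<in>U. dist (f x) (f y) < \<epsilon>))"
  using Met_TC.continuous_map_to_metric[of X f] by simp

lemma topological_quiverD:
  assumes "topological_quiver Q"
  shows "lc_Hausdorff (verts Q)" "second_countable (verts Q)"
    "lc_Hausdorff (edges Q)" "second_countable (edges Q)"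
    "Hausdorff_space (verts Q)" "Hausdorff_space (edges Q)"
    "continuous_map (edges Q) (verts Q) (rng Q)"
    "continuous_map (edges Q) (verts Q) (src Q)"
    "open_map (edges Q) (verts Q) (src Q)"
    and "v \<in> topspace (verts Q) \<Longrightarrow> radon_measure (edges Q) (lam Q v)"
    "v \<in> topspace (verts Q) \<Longrightarrow> emeasure (lam Q v) (topspace (edges Q)) \<noteq> 0"
    "v \<in> topspace (verts Q) \<Longrightarrow> measure_supp (edges Q) (lam Q v) = {e \<in> topspace (edges Q). src Q e = v}"
    "\<xi> \<in> Cc (edges Q) \<Longrightarrow> continuous_map (verts Q) euclidean (\<lambda>v. LINT e|lam Q v. \<xi> e)"
  using assms by (simp_all add: topological_quiver_def lc_Hausdorff_def)

lemma closedin_fibre: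
  assumes "continuous_map X Y f" "Hausdorff_space Y" "y \<in> topspace Y"
  shows "closedin X {x \<in> topspace X. f x = y}"
  using closedin_continuous_map_preimage[OF assms(1), of "{y}"] assms(2,3)
  by (simp add: closedin_Hausdorff_singleton)

lemma lam_null_off_fibre:
  assumes "topological_quiver Q" "v \<in> topspace (verts Q)"
  shows "emeasure (lam Q v) (topspace (edges Q) - {e \<in> topspace (edges Q). src Q e = v}) = 0"
proof (rule radon_measure_null_off_supp)
  show "closedin (edges Q) {e \<in> topspace (edges Q). src Q e = v}"
    using topological_quiverD[OF assms(1)] assms(2) by (intro closedin_fibre)
qed (use topological_quiverD[OF assms(1)] assms(2) in auto)

lemma integral_norm_le:
  fixes f :: "'a \<Rightarrow> 'b::{banach, second_countable_topology}" and g :: "'a \<Rightarrow> real"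
  assumes "integrable M f" "integrable M g" "\<And>x. x \<in> space M \<Longrightarrow> norm (f x) \<le> g x"
  shows "norm (LINT x|M. f x) \<le> (LINT x|M. g x)"
proof -
  have "(LINT x|M. norm (f x)) \<le> (LINT x|M. g x)"
    using assms by (intro integral_mono) auto
  then show ?thesis
    using integral_norm_bound[of M f] by linarith
qed

text \<open>The supports stay in the compact set \<open>K\<close>, so the tube lemma gives uniform convergence of
  \<open>\<Psi> (_, p)\<close>, while the mass of \<open>K\<close> stays locally bounded.\<close>

lemma continuous_map_lam_integral:
  fixes \<Psi> :: "'e \<times> 'p \<Rightarrow> complex"
  assumes Q: "topological_quiver Q" and f: "continuous_map P (verts Q) f"
    and \<Psi>: "continuous_map (prod_topology (edges Q) P) euclidean \<Psi>"
    and K: "compactin (edges Q) K" and \<Psi>0: "\<And>e p. e \<in> topspace (edges Q) \<Longrightarrow> e \<notin> K \<Longrightarrow> \<Psi> (e, p) = 0"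
  shows "continuous_map P euclidean (\<lambda>p. LINT e|lam Q (f p). \<Psi> (e, p))"
  unfolding continuous_map_euclidean_iff
proof (intro ballI allI impI)
  fix p0 and \<epsilon> :: real
  assume p0: "p0 \<in> topspace P" and \<epsilon>: "\<epsilon> > 0"
  note Q' = topological_quiverD[OF Q]
  have slice: "(\<lambda>e. \<Psi> (e, p)) \<in> Cc (edges Q)" if "p \<in> topspace P" for p
  proof (rule CcI[OF Q'(6) _ K])
    have "continuous_map (edges Q) (prod_topology (edges Q) P) (\<lambda>e. (e, p))"
      using that by (simp add: continuous_map_paired)
    then show "continuous_map (edges Q) euclidean (\<lambda>e. \<Psi> (e, p))"
      using continuous_map_compose[OF _ \<Psi>] by (simp add: o_def)
  qed (rule \<Psi>0)
  define g where "g e = \<Psi> (e, p0)" for e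
  have g: "g \<in> Cc (edges Q)"
    using slice[OF p0] unfolding g_def .
  obtain \<kappa> :: "_ \<Rightarrow> real" where \<kappa>: "continuous_map (edges Q) euclidean \<kappa>"
    "\<And>e. 0 \<le> \<kappa> e" "\<And>e. \<kappa> e \<le> 1" "\<And>e. e \<in> K \<Longrightarrow> \<kappa> e = 1"
    "\<And>e. e \<notin> topspace (edges Q) \<Longrightarrow> \<kappa> e = 0" "(\<lambda>e. complex_of_real (\<kappa> e)) \<in> Cc (edges Q)"
    using Cc_Urysohn[OF Q'(3) K openin_topspace compactin_subset_topspace[OF K]] by auto
  \<comment> \<open>The difference between the integrals at \<open>p0\<close> and \<open>p\<close>
    is split in two: \<open>A\<close> lets the measure move with the integrand frozen at
    \<open>p0\<close>, while \<open>B\<close> bounds the mass against which the change of integrand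
    is measured.\<close>
  define A where "A p = (LINT e|lam Q (f p). g e)" for p
  define B where "B p = (LINT e|lam Q (f p). \<kappa> e)" for p
  have A: "continuous_map P euclidean A"
    using continuous_map_compose[OF f Q'(13)[OF g]] by (simp add: o_def A_def[abs_def])
  have B: "continuous_map P euclidean (\<lambda>p. complex_of_real (B p))"
    using continuous_map_compose[OF f Q'(13)[OF \<kappa>(6)]] by (simp add: o_def B_def)
  \<comment> \<open>On \<open>V3\<close> the values of \<open>B\<close> stay within 1 of
    \<open>B p0\<close>, hence below \<open>c\<close>; so a uniform error \<open>\<delta>\<close> in
    the integrand costs less than \<open>\<delta> * c\<close>, half of
    \<open>\<epsilon>\<close>.\<close>
  define c where "c = B p0 + 1"
  have "B p0 \<ge> 0"
    unfolding B_def using \<kappa>(2) by (intro Bochner_Integration.integral_nonneg)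
  then have c: "c > 0" by (simp add: c_def)
  define \<delta> where "\<delta> = \<epsilon> / (2 * c)"
  have \<delta>: "\<delta> > 0" "\<delta> * c = \<epsilon> / 2" using \<epsilon> c by (auto simp: \<delta>_def)
  let ?W = "{z \<in> topspace (prod_topology (edges Q) P). dist (\<Psi> z) (g (fst z)) \<in> {..<\<delta>}}"
  have g': "continuous_map (prod_topology (edges Q) P) euclidean (\<lambda>z. g (fst z))"
    using continuous_map_compose[OF continuous_map_fst Cc_continuous_map[OF g]] by (simp add: o_def)
  have "continuous_map (prod_topology (edges Q) P) euclideanreal (\<lambda>z. norm (\<Psi> z - g (fst z)))"
    by (intro continuous_map_norm continuous_map_diff \<Psi> g')
  then have "openin (prod_topology (edges Q) P) ?W"
    unfolding dist_norm by (rule openin_continuous_map_preimage) auto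
  moreover have "K \<times> {p0} \<subseteq> ?W"
    using compactin_subset_topspace[OF K] p0 \<delta> by (auto simp: g_def)
  ultimately obtain U V1 where V1: "openin P V1" "p0 \<in> V1" "K \<subseteq> U" "U \<times> V1 \<subseteq> ?W"
    using tube_lemma_left[OF _ K p0, of ?W] by blast
  obtain V2 where V2: "openin P V2" "p0 \<in> V2" "\<forall>p\<in>V2. dist (A p0) (A p) < \<epsilon> / 2"
    using A[unfolded continuous_map_euclidean_iff, rule_format, OF p0, of "\<epsilon> / 2"] \<epsilon> by auto
  obtain V3 where V3: "openin P V3" "p0 \<in> V3"
    "\<forall>p\<in>V3. dist (complex_of_real (B p0)) (complex_of_real (B p)) < 1"
    using B[unfolded continuous_map_euclidean_iff, rule_format, OF p0, of 1] by auto
  show "\<exists>V. openin P V \<and> p0 \<in> V \<and>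
      (\<forall>p\<in>V. dist (LINT e|lam Q (f p0). \<Psi> (e, p0)) (LINT e|lam Q (f p). \<Psi> (e, p)) < \<epsilon>)"
  proof (intro exI conjI ballI)
    show "openin P (V1 \<inter> V2 \<inter> V3)" "p0 \<in> V1 \<inter> V2 \<inter> V3"
      using V1 V2 V3 by auto
    fix p assume p: "p \<in> V1 \<inter> V2 \<inter> V3"
    have pP: "p \<in> topspace P" using p openin_subset[OF V1(1)] by blast
    have fp: "f p \<in> topspace (verts Q)"
      using continuous_map_image_subset_topspace[OF f] pP by blast
    note radon = Q'(10)[OF fp]
    note int = integrable_Cc[OF Q'(6) radon]
    have \<kappa>i: "integrable (lam Q (f p)) \<kappa>"
      using int[OF \<kappa>(6)] by (simp add: complex_of_real_integrable_eq)
    have "norm ((LINT e|lam Q (f p). \<Psi> (e, p)) - A p) = norm (LINT e|lam Q (f p). \<Psi> (e, p) - g e)"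
      unfolding A_def by (subst Bochner_Integration.integral_diff[OF int[OF slice[OF pP]] int[OF g]]) (rule refl)
    also have "\<dots> \<le> \<delta> * B p"
      unfolding B_def integral_mult_right_zero[symmetric]
    proof (rule integral_norm_le)
      show "integrable (lam Q (f p)) (\<lambda>e. \<Psi> (e, p) - g e)"
        using int[OF slice[OF pP]] int[OF g] by simp
      show "integrable (lam Q (f p)) (\<lambda>e. \<delta> * \<kappa> e)"
        using \<kappa>i by simp
      fix e assume "e \<in> space (lam Q (f p))"
      then have e: "e \<in> topspace (edges Q)" using radon_measureD(1)[OF radon] by simp
      show "norm (\<Psi> (e, p) - g e) \<le> \<delta> * \<kappa> e"
      proof (cases "e \<in> K")
        case True
        then have "(e, p) \<in> ?W" using p by (intro subsetD[OF V1(4)] SigmaI subsetD[OF V1(3)]) auto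
        then show ?thesis using True \<kappa>(4) by (simp add: dist_norm)
      next
        case False
        then show ?thesis using \<Psi>0[OF e] \<delta> \<kappa>(2) by (simp add: g_def)
      qed
    qed
    also have "\<dots> < \<delta> * c"
    proof (rule mult_strict_left_mono[OF _ \<delta>(1)])
      have "\<bar>B p0 - B p\<bar> < 1"
        using V3(3) p by (auto simp only: dist_of_real dist_real_def Int_iff)
      then show "B p < c" by (simp add: c_def)
    qed
    finally have 1: "norm ((LINT e|lam Q (f p). \<Psi> (e, p)) - A p) < \<epsilon> / 2"
      using \<delta>(2) by simp
    have "dist (A p0) (A p) < \<epsilon> / 2"
      using V2(3) p by blast
    moreover have "dist (LINT e|lam Q (f p). \<Psi> (e, p)) (A p) < \<epsilon> / 2"
      using 1 unfolding dist_norm .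
    ultimately have "dist (A p0) (LINT e|lam Q (f p). \<Psi> (e, p)) < \<epsilon>"
      by (rule dist_triangle_half_l)
    then show "dist (LINT e|lam Q (f p0). \<Psi> (e, p0)) (LINT e|lam Q (f p). \<Psi> (e, p)) < \<epsilon>"
      by (simp add: A_def g_def)
  qed
qed

section \<open>Pullbacks of spaces\<close>

lemma topspace_pullback:
  "topspace (pullback X f P q) = {(x, p). x \<in> topspace X \<and> p \<in> topspace P \<and> f x = q p}"
  by (auto simp: pullback_def)

lemma closedin_pullback:
  assumes f: "continuous_map X B f" and q: "continuous_map P B q" and B: "Hausdorff_space B"
  shows "closedin (prod_topology X P) {(x, p). x \<in> topspace X \<and> p \<in> topspace P \<and> f x = q p}"
proof -
  have "continuous_map (prod_topology X P) B (\<lambda>z. f (fst z))" "continuous_map (prod_topology X P) B (\<lambda>z. q (snd z))"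
    using continuous_map_compose[OF continuous_map_fst f] continuous_map_compose[OF continuous_map_snd q]
    by (simp_all add: o_def)
  then have "closedin (prod_topology X P) {z \<in> topspace (prod_topology X P). f (fst z) = q (snd z)}"
    by (rule closedin_continuous_maps_eq[OF B])
  moreover have "{z \<in> topspace (prod_topology X P). f (fst z) = q (snd z)}
      = {(x, p). x \<in> topspace X \<and> p \<in> topspace P \<and> f x = q p}"
    by auto
  ultimately show ?thesis by simp
qed

lemma lc_Hausdorff_pullback:
  assumes "lc_Hausdorff X" "lc_Hausdorff P" "continuous_map X B f" "continuous_map P B q" "Hausdorff_space B"
  shows "lc_Hausdorff (pullback X f P q)"
  unfolding pullback_def
  using lc_Hausdorff_closed_subtopology[OF lc_Hausdorff_prod_topology[OF assms(1,2)] closedin_pullback[OF assms(3-5)]] .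

lemma second_countable_pullback:
  "second_countable X \<Longrightarrow> second_countable P \<Longrightarrow> second_countable (pullback X f P q)"
  unfolding pullback_def by (intro second_countable_subtopology second_countable_prod_topology)

lemma continuous_map_fst_pullback: "continuous_map (pullback X f P q) X fst"
  and continuous_map_snd_pullback: "continuous_map (pullback X f P q) P snd"
  by (simp_all add: pullback_def continuous_map_from_subtopology continuous_map_fst continuous_map_snd)

lemma continuous_map_into_pullback:
  assumes "continuous_map Z X g" "continuous_map Z P h" "\<And>z. z \<in> topspace Z \<Longrightarrow> f (g z) = q (h z)"
  shows "continuous_map Z (pullback X f P q) (\<lambda>z. (g z, h z))"
  using assms continuous_map_image_subset_topspace[OF assms(1)] continuous_map_image_subset_topspace[OF assms(2)]
  unfolding pullback_def continuous_map_in_subtopology continuous_map_paired by blast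

text \<open>Openness of \<open>f\<close> supplies partners: if \<open>(x, p)\<close> has a box
  neighbourhood \<open>V1 \<times> V2\<close>, every \<open>p'\<close> in \<open>V2\<close> with
  \<open>q p'\<close> in the open image of \<open>V1\<close> is paired with some \<open>x'\<close>
  in \<open>V1\<close>, so a whole neighbourhood of \<open>p\<close> is hit.\<close>

lemma open_map_snd_pullback:
  assumes f: "open_map X B f" and q: "continuous_map P B q"
  shows "open_map (pullback X f P q) P snd"
  unfolding open_map_def
proof (intro allI impI)
  fix U assume U: "openin (pullback X f P q) U"
  obtain W where W: "openin (prod_topology X P) W"
    "U = W \<inter> {(x, p). x \<in> topspace X \<and> p \<in> topspace P \<and> f x = q p}"
    using U[unfolded pullback_def openin_subtopology] by (elim exE conjE) (rule that)
  show "openin P (snd ` U)"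
  proof (subst openin_subopen, intro ballI)
    fix p assume "p \<in> snd ` U"
    then obtain x where x: "(x, p) \<in> U" by (metis imageE prod.collapse)
    then have xp: "(x, p) \<in> W" "p \<in> topspace P" "f x = q p" unfolding W(2) by simp_all
    then obtain V1 V2 where V: "openin X V1" "openin P V2" "x \<in> V1" "p \<in> V2" "V1 \<times> V2 \<subseteq> W"
      using W(1)[unfolded openin_prod_topology_alt, rule_format, OF xp(1)] by auto
    have "openin P (V2 \<inter> {p \<in> topspace P. q p \<in> f ` V1})"
      using V(1,2) f by (intro openin_Int openin_continuous_map_preimage[OF q]) (auto simp: open_map_def)
    moreover have "p \<in> V2 \<inter> {p \<in> topspace P. q p \<in> f ` V1}"
      using xp(2) V(3,4) by (auto simp flip: xp(3))
    moreover have "V2 \<inter> {p \<in> topspace P. q p \<in> f ` V1} \<subseteq> snd ` U"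
    proof
      fix p' assume p': "p' \<in> V2 \<inter> {p \<in> topspace P. q p \<in> f ` V1}"
      then obtain x' where "x' \<in> V1" "f x' = q p'" by auto
      then have "(x', p') \<in> U"
        using p' V W(2) openin_subset[OF V(1)] by auto
      then show "p' \<in> snd ` U" by force
    qed
    ultimately show "\<exists>T. openin P T \<and> p \<in> T \<and> T \<subseteq> snd ` U" by blast
  qed
qed

lemma Cc_compose_proper:
  assumes "f \<in> Cc Y" "continuous_map X Y h" "proper_map X Y h" "Hausdorff_space X"
  shows "(\<lambda>x. f (h x)) \<in> Cc X"
proof -
  obtain K where K: "compactin Y K" "\<And>y. y \<in> topspace Y \<Longrightarrow> y \<notin> K \<Longrightarrow> f y = 0"
    using CcE[OF assms(1)] by metis
  show ?thesis
  proof (rule CcI[OF assms(4)])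
    show "continuous_map X euclidean (\<lambda>x. f (h x))"
      using continuous_map_compose[OF assms(2) Cc_continuous_map[OF assms(1)]] by (simp add: o_def)
    show "compactin X {x \<in> topspace X. h x \<in> K}"
      using compactin_proper_map_preimage[OF assms(3) K(1)] .
    show "f (h x) = 0" if "x \<in> topspace X" "x \<notin> {x \<in> topspace X. h x \<in> K}" for x
      using that K(2) continuous_map_image_subset_topspace[OF assms(2)] by blast
  qed
qed

section \<open>The quiver of a principal bundle\<close>

lemma lc_groupD:
  assumes "lc_group G T"
  shows "group G" "topspace T = carrier G" "\<one>\<^bsub>G\<^esub> \<in> carrier G"
    "g \<in> carrier G \<Longrightarrow> inv\<^bsub>G\<^esub> g \<in> carrier G"
    "g \<in> carrier G \<Longrightarrow> h \<in> carrier G \<Longrightarrow> g \<otimes>\<^bsub>G\<^esub> h \<in> carrier G"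
    "g \<in> carrier G \<Longrightarrow> g \<otimes>\<^bsub>G\<^esub> inv\<^bsub>G\<^esub> g = \<one>\<^bsub>G\<^esub>"
    "g \<in> carrier G \<Longrightarrow> inv\<^bsub>G\<^esub> g \<otimes>\<^bsub>G\<^esub> g = \<one>\<^bsub>G\<^esub>"
proof -
  show G: "group G" using assms by (simp add: lc_group_def)
  interpret group G by (rule G)
  show "topspace T = carrier G" "\<one>\<^bsub>G\<^esub> \<in> carrier G"
    using assms by (simp_all add: lc_group_def)
  show "g \<in> carrier G \<Longrightarrow> inv\<^bsub>G\<^esub> g \<in> carrier G"
    "g \<in> carrier G \<Longrightarrow> h \<in> carrier G \<Longrightarrow> g \<otimes>\<^bsub>G\<^esub> h \<in> carrier G"
    "g \<in> carrier G \<Longrightarrow> g \<otimes>\<^bsub>G\<^esub> inv\<^bsub>G\<^esub> g = \<one>\<^bsub>G\<^esub>"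
    "g \<in> carrier G \<Longrightarrow> inv\<^bsub>G\<^esub> g \<otimes>\<^bsub>G\<^esub> g = \<one>\<^bsub>G\<^esub>"
    by simp_all
qed

section \<open>Continuous right actions and their orbits\<close>

locale topological_action =
  fixes G :: "'g monoid" and T :: "'g topology" and X :: "'x topology" and act :: "'x \<Rightarrow> 'g \<Rightarrow> 'x"
  assumes group: "lc_group G T" and action: "right_action G T X act"
begin

lemmas G = lc_groupD[OF group]

lemma continuous: "continuous_map (prod_topology X T) X (\<lambda>(x, g). act x g)"
  and act_one: "x \<in> topspace X \<Longrightarrow> act x \<one>\<^bsub>G\<^esub> = x"
  and act_act: "x \<in> topspace X \<Longrightarrow> g \<in> carrier G \<Longrightarrow> h \<in> carrier G \<Longrightarrow> act (act x g) h = act x (g \<otimes>\<^bsub>G\<^esub> h)"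
  using action by (simp_all add: right_action_def)

lemma act_closed: "x \<in> topspace X \<Longrightarrow> g \<in> carrier G \<Longrightarrow> act x g \<in> topspace X"
  using continuous_map_image_subset_topspace[OF continuous] G(2) by force

lemma act_inv: "x \<in> topspace X \<Longrightarrow> g \<in> carrier G \<Longrightarrow> act (act x g) (inv\<^bsub>G\<^esub> g) = x"
  and act_inv': "x \<in> topspace X \<Longrightarrow> g \<in> carrier G \<Longrightarrow> act (act x (inv\<^bsub>G\<^esub> g)) g = x"
  by (simp_all add: act_act act_one G)

lemma continuous_act:
  assumes "continuous_map Z X f" "continuous_map Z T g"
  shows "continuous_map Z X (\<lambda>z. act (f z) (g z))"
  using continuous_map_compose[OF _ continuous, of Z "\<lambda>z. (f z, g z)"] assms
  by (simp add: continuous_map_paired o_def)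

lemma continuous_translation: "g \<in> carrier G \<Longrightarrow> continuous_map X X (\<lambda>x. act x g)"
  by (rule continuous_act) (simp_all add: G(2))

lemma homeomorphic_translation:
  assumes "g \<in> carrier G"
  shows "homeomorphic_map X X (\<lambda>x. act x g)"
proof -
  have "homeomorphic_maps X X (\<lambda>x. act x g) (\<lambda>x. act x (inv\<^bsub>G\<^esub> g))"
    using assms by (simp add: homeomorphic_maps_def continuous_translation G act_inv act_inv')
  then show ?thesis by (rule homeomorphic_maps_imp_map)
qed

lemma orbit_act:
  assumes "x \<in> topspace X" "g \<in> carrier G"
  shows "orbit_of G act (act x g) = orbit_of G act x"
proof -
  have "\<exists>h\<in>carrier G. act x k = act (act x g) h" if "k \<in> carrier G" for k
    using that assms act_act[OF act_closed[OF assms], of "inv\<^bsub>G\<^esub> g" k]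
    by (intro bexI[of _ "inv\<^bsub>G\<^esub> g \<otimes>\<^bsub>G\<^esub> k"]) (simp_all add: G act_inv)
  then show ?thesis
    using assms by (auto simp: orbit_of_def act_act G)
qed

lemma orbit_eqE:
  assumes "x \<in> topspace X" "y \<in> topspace X" "orbit_of G act x = orbit_of G act y"
  obtains g where "g \<in> carrier G" "y = act x g"
proof -
  have "y \<in> orbit_of G act y"
    using assms(2) G(3) act_one unfolding orbit_of_def by force
  then show thesis
    using that assms(3) unfolding orbit_of_def by auto
qed

end

lemma continuous_map_scaleR:
  fixes g :: "'a \<Rightarrow> 'b::real_normed_vector"
  shows "\<lbrakk>continuous_map X euclideanreal f; continuous_map X euclidean g\<rbrakk>
    \<Longrightarrow> continuous_map X euclidean (\<lambda>x. f x *\<^sub>R g x)"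
  by (simp add: continuous_map_atin tendsto_scaleR)

section \<open>The quiver \<open>Q(P,\<theta>)\<close>: measures, topology and action\<close>

locale quiver_bundle = topological_action G T P act
  for G :: "'g monoid" and T :: "'g topology" and P :: "'p topology" and act +
  fixes Q :: "('v, 'e) quiver" and q :: "'p \<Rightarrow> 'v" and \<theta> :: "'e \<times> 'p \<Rightarrow> 'e \<times> 'p"
  assumes Q: "topological_quiver Q"
    and principal: "principal_bundle G T P act (verts Q) q" and P2: "second_countable P"
    and iso: "pullback_bundle_iso G (edges Q) P act q (src Q) (rng Q) \<theta>"
begin

lemmas Q' = topological_quiverD[OF Q]

abbreviation E1 where "E1 \<equiv> pullback (edges Q) (src Q) P q"
abbreviation fibre where "fibre v \<equiv> {e \<in> topspace (edges Q). src Q e = v}"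
text \<open>The explicit candidate for the measure that \<open>bundle_lam\<close> only
  describes.\<close>

abbreviation bmeasure where "bmeasure v \<equiv> pushforward (lam Q (q v)) (fibre (q v)) E1 (\<lambda>e. (e, v))"

lemma P: "lc_Hausdorff P" and q: "continuous_map P (verts Q) q"
  using principal by (simp_all add: principal_bundle_def)

lemma q_closed: "v \<in> topspace P \<Longrightarrow> q v \<in> topspace (verts Q)"
  using continuous_map_image_subset_topspace[OF q] by blast

lemma q_act:
  assumes "p \<in> topspace P" "g \<in> carrier G"
  shows "q (act p g) = q p"
proof -
  obtain h where h: "\<forall>p \<in> topspace P. h (orbit_of G act p) = q p"
    using principal by (auto simp: principal_bundle_def)
  show ?thesis
    using h[rule_format, OF assms(1)] h[rule_format, OF act_closed[OF assms]] orbit_act[OF assms] by simp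
qed

lemma lc_Hausdorff_E1: "lc_Hausdorff E1"
  by (rule lc_Hausdorff_pullback[OF Q'(3) P Q'(8) q Q'(5)])

lemma Hausdorff_E1: "Hausdorff_space E1"
  using lc_Hausdorff_E1 by (simp add: lc_Hausdorff_def)

lemma closedin_fibre: "v \<in> topspace P \<Longrightarrow> closedin (edges Q) (fibre (q v))"
  by (rule closedin_fibre[OF Q'(8,5) q_closed])

lemma radon_pushforward_fibre:
  assumes v: "v \<in> topspace P"
  shows "radon_pushforward (edges Q) (lam Q (q v)) (fibre (q v)) E1 (\<lambda>e. (e, v))"
proof
  show cont: "continuous_map (subtopology (edges Q) (fibre (q v))) E1 (\<lambda>e. (e, v))"
    using v by (intro continuous_map_into_pullback) (auto intro: continuous_map_from_subtopology)
  show "proper_map (subtopology (edges Q) (fibre (q v))) E1 (\<lambda>e. (e, v))"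
  \<comment> \<open>The first projection undoes \<open>e \<mapsto> (e, v)\<close>: the composite is
    the inclusion of a closed fibre, which is proper, and properness passes to the inner map because
    \<open>E1\<close> is Hausdorff.\<close>
  proof (rule proper_map_from_composition_right[OF Hausdorff_E1 _ cont continuous_map_fst_pullback])
    have "proper_map (subtopology (edges Q) (fibre (q v))) (edges Q) id"
      using closed_map_inclusion[OF closedin_fibre[OF v]] by (intro closed_injective_imp_proper_map) auto
    then show "proper_map (subtopology (edges Q) (fibre (q v))) (edges Q) (fst \<circ> (\<lambda>e. (e, v)))"
      by (simp add: o_def id_def)
  qed
qed (use Q' q_closed[OF v] Hausdorff_E1 closedin_fibre[OF v] lam_null_off_fibre[OF Q] in auto)

lemma integral_bmeasure:
  assumes v: "v \<in> topspace P" and \<phi>: "continuous_map E1 euclidean \<phi>"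
  shows "(LINT z|bmeasure v. \<phi> z) = fibre_integral Q q v \<phi>"
proof -
  interpret radon_pushforward "edges Q" "lam Q (q v)" "fibre (q v)" E1 "\<lambda>e. (e, v)"
    by (rule radon_pushforward_fibre[OF v])
  show ?thesis
    unfolding fibre_integral_def using \<phi> by (intro integral_eq continuous_map_borel_measurable) auto
qed

lemma radon_bmeasure: "v \<in> topspace P \<Longrightarrow> radon_measure E1 (bmeasure v)"
  by (rule radon_pushforward.radon[OF radon_pushforward_fibre])

lemma bundle_lam_eq:
  assumes v: "v \<in> topspace P"
  shows "bundle_lam Q P q v = bmeasure v"
  unfolding bundle_lam_def
proof (rule the_equality)
  show "radon_measure E1 (bmeasure v) \<and> (\<forall>\<phi>\<in>Cc E1. (LINT z|bmeasure v. \<phi> z) = fibre_integral Q q v \<phi>)"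
    using v by (simp add: radon_bmeasure integral_bmeasure Cc_continuous_map)
  fix \<mu> assume "radon_measure E1 \<mu> \<and> (\<forall>\<phi>\<in>Cc E1. (LINT z|\<mu>. \<phi> z) = fibre_integral Q q v \<phi>)"
  then show "\<mu> = bmeasure v"
    using v by (intro radon_measure_eqI[OF lc_Hausdorff_E1])
      (simp_all add: radon_bmeasure integral_bmeasure Cc_continuous_map)
qed

lemma bundle_lam_integral:
  "v \<in> topspace P \<Longrightarrow> \<phi> \<in> Cc E1 \<Longrightarrow> (LINT z|bundle_lam Q P q v. \<phi> z) = fibre_integral Q q v \<phi>"
  by (simp add: bundle_lam_eq integral_bmeasure Cc_continuous_map)

lemma bundle_lam_continuous:
  assumes \<xi>: "\<xi> \<in> Cc E1"
  shows "continuous_map P euclidean (\<lambda>v. LINT z|bundle_lam Q P q v. \<xi> z)"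
proof -
  let ?S = "{(x, p). x \<in> topspace (edges Q) \<and> p \<in> topspace P \<and> src Q x = q p}"
  have normal: "normal_space (prod_topology (edges Q) P)"
    using Q'(3,4) P P2
    by (intro lc_Hausdorff_second_countable_imp_normal_space lc_Hausdorff_prod_topology second_countable_prod_topology)
  have closed: "closedin (prod_topology (edges Q) P) ?S"
    by (rule closedin_pullback[OF Q'(8) q Q'(5)])
  obtain \<Xi> where \<Xi>: "continuous_map (prod_topology (edges Q) P) euclidean \<Xi>"
    "\<And>z. z \<in> ?S \<Longrightarrow> \<Xi> z = \<xi> z"
    by (rule Tietze_extension_complex[OF normal closed Cc_continuous_map[OF \<xi>, unfolded pullback_def]]) (rule that)
  obtain K where K: "compactin E1 K" "\<And>z. z \<in> topspace E1 \<Longrightarrow> z \<notin> K \<Longrightarrow> \<xi> z = 0"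
    using CcE[OF \<xi>] by metis
  have fK: "compactin (edges Q) (fst ` K)"
    by (rule image_compactin[OF K(1) continuous_map_fst_pullback])
  obtain \<kappa> :: "_ \<Rightarrow> real" where \<kappa>: "continuous_map (edges Q) euclidean \<kappa>"
    "\<And>e. 0 \<le> \<kappa> e" "\<And>e. \<kappa> e \<le> 1" "\<And>e. e \<in> fst ` K \<Longrightarrow> \<kappa> e = 1"
    "\<And>e. e \<notin> topspace (edges Q) \<Longrightarrow> \<kappa> e = 0" "(\<lambda>e. complex_of_real (\<kappa> e)) \<in> Cc (edges Q)"
    by (rule Cc_Urysohn[OF Q'(3) fK openin_topspace compactin_subset_topspace[OF fK]]) (rule that)
  obtain L where L: "compactin (edges Q) L" "\<And>e. e \<in> topspace (edges Q) \<Longrightarrow> e \<notin> L \<Longrightarrow> complex_of_real (\<kappa> e) = 0"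
    using CcE[OF \<kappa>(6)] by metis
  \<comment> \<open>The Tietze extension \<open>\<Xi>\<close> need not have compact support in the
    edge direction, so it is cut off by \<open>\<kappa>\<close>, which is 1 on the projection of the
    support set \<open>K\<close>. On the pullback nothing changes: off \<open>K\<close> the function
    \<open>\<xi>\<close>, and with it \<open>\<Xi>\<close>, is already zero.\<close>
  define \<Psi> where "\<Psi> z = \<kappa> (fst z) *\<^sub>R \<Xi> z" for z
  have \<kappa>': "continuous_map (prod_topology (edges Q) P) euclideanreal (\<lambda>z. \<kappa> (fst z))"
    using continuous_map_compose[OF continuous_map_fst \<kappa>(1)] by (simp add: o_def)
  have \<Psi>: "continuous_map (prod_topology (edges Q) P) euclidean \<Psi>"
    unfolding \<Psi>_def[abs_def] by (intro continuous_map_scaleR \<kappa>' \<Xi>(1))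
  have \<Psi>\<xi>: "\<Psi> z = \<xi> z" if "z \<in> topspace E1" for z
    using that K(2)[OF that] \<Xi>(2)[of z] \<kappa>(4)[of "fst z"] by (cases "z \<in> K") (auto simp: \<Psi>_def topspace_pullback)
  have eq: "(LINT z|bundle_lam Q P q v. \<xi> z) = (LINT e|lam Q (q v). \<Psi> (e, v))" if v: "v \<in> topspace P" for v
  proof -
    interpret radon_pushforward "edges Q" "lam Q (q v)" "fibre (q v)" E1 "\<lambda>e. (e, v)"
      by (rule radon_pushforward_fibre[OF v])
    have "continuous_map (edges Q) (prod_topology (edges Q) P) (\<lambda>e. (e, v))"
      using v by (simp add: continuous_map_paired)
    then have "continuous_map (edges Q) euclidean (\<lambda>e. \<Psi> (e, v))"
      using continuous_map_compose[OF _ \<Psi>] by (simp add: o_def)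
    then have m: "(\<lambda>e. \<Psi> (e, v)) \<in> borel_measurable (lam Q (q v))"
      by (rule continuous_map_borel_measurable[OF sets_M])
    have "(LINT z|bundle_lam Q P q v. \<xi> z) = (LINT e:fibre (q v)|lam Q (q v). \<xi> (e, v))"
      using bundle_lam_integral[OF v \<xi>] by (simp add: fibre_integral_def)
    also have "\<dots> = (LINT e:fibre (q v)|lam Q (q v). \<Psi> (e, v))"
      unfolding set_lebesgue_integral_def using v
      by (intro Bochner_Integration.integral_cong refl) (auto simp: indicator_def \<Psi>\<xi> topspace_pullback)
    also have "\<dots> = (LINT e|lam Q (q v). \<Psi> (e, v))"
      by (rule set_integral_C[OF m])
    finally show ?thesis .
  qed
  have "continuous_map P euclidean (\<lambda>v. LINT e|lam Q (q v). \<Psi> (e, v))"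
    using L(2) by (intro continuous_map_lam_integral[OF Q q \<Psi> L(1)]) (simp add: \<Psi>_def)
  then show ?thesis
    by (rule continuous_map_eq) (simp add: eq)
qed

lemma topological_quiver_bundle_quiver: "topological_quiver (bundle_quiver Q P q \<theta>)"
proof -
  have \<theta>: "continuous_map E1 (pullback (edges Q) (rng Q) P q) \<theta>"
    using iso by (simp add: pullback_bundle_iso_def homeomorphic_imp_continuous_map)
  have rng: "continuous_map E1 P (\<lambda>z. snd (\<theta> z))"
    using continuous_map_compose[OF \<theta> continuous_map_snd_pullback] by (simp add: o_def)
  have lam: "radon_measure E1 (bundle_lam Q P q v) \<and> emeasure (bundle_lam Q P q v) (topspace E1) \<noteq> 0 \<and>
      measure_supp E1 (bundle_lam Q P q v) = {z \<in> topspace E1. snd z = v}" if v: "v \<in> topspace P" for v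
  proof -
    interpret radon_pushforward "edges Q" "lam Q (q v)" "fibre (q v)" E1 "\<lambda>e. (e, v)"
      by (rule radon_pushforward_fibre[OF v])
    have "(\<lambda>e. (e, v)) ` fibre (q v) = {z \<in> topspace E1. snd z = v}"
      using v by (force simp: topspace_pullback)
    then show ?thesis
      using radon emeasure_topspace measure_supp_eq Q'(11,12)[OF q_closed[OF v]]
      by (simp add: bundle_lam_eq[OF v])
  qed
  show ?thesis
    unfolding topological_quiver_def bundle_quiver_def quiver.simps
    using P P2 lc_Hausdorff_E1 second_countable_pullback[OF Q'(4) P2] rng continuous_map_snd_pullback
      open_map_snd_pullback[OF Q'(9) q] lam bundle_lam_continuous by auto
qed

lemma right_action_pullback_act: "right_action G T E1 (pullback_act act)"
proof -
  have fst: "continuous_map (prod_topology E1 T) (edges Q) (\<lambda>z. fst (fst z))"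
    using continuous_map_compose[OF continuous_map_fst continuous_map_fst_pullback] by (simp add: o_def)
  have snd: "continuous_map (prod_topology E1 T) P (\<lambda>z. snd (fst z))"
    using continuous_map_compose[OF continuous_map_fst continuous_map_snd_pullback] by (simp add: o_def)
  have "continuous_map (prod_topology E1 T) E1 (\<lambda>z. (fst (fst z), act (snd (fst z)) (snd z)))"
    by (intro continuous_map_into_pullback fst continuous_act snd continuous_map_snd)
      (auto simp: topspace_pullback q_act G)
  then show ?thesis
    unfolding right_action_def
    by (auto simp: pullback_act_def case_prod_unfold topspace_pullback act_one act_act)
qed

lemma principal_quiver_action_bundle_quiver:
  "principal_quiver_action G T (bundle_quiver Q P q \<theta>) act (pullback_act act)"
proof -
  interpret E1: topological_action G T E1 "pullback_act act"
    by unfold_locales (rule group, rule right_action_pullback_act)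
  have integral: "(LINT z|bundle_lam Q P q v. \<phi> (pullback_act act z g)) = (LINT z|bundle_lam Q P q (act v g). \<phi> z)"
    if \<phi>: "\<phi> \<in> Cc E1" and v: "v \<in> topspace P" and g: "g \<in> carrier G" for \<phi> v g
  proof -
    have "(\<lambda>z. \<phi> (pullback_act act z g)) \<in> Cc E1"
      using E1.homeomorphic_translation[OF g] \<phi>
      by (intro Cc_compose_proper[OF \<phi> E1.continuous_translation[OF g] _ Hausdorff_E1] homeomorphic_imp_proper_map)
    then have "(LINT z|bundle_lam Q P q v. \<phi> (pullback_act act z g)) = fibre_integral Q q v (\<lambda>z. \<phi> (pullback_act act z g))"
      by (rule bundle_lam_integral[OF v])
    \<comment> \<open>\<open>q\<close> is constant on orbits, so both sides integrate
      \<open>\<phi> (e, act v g)\<close> over the same fibre against the same measure: invariance is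
      built into the construction.\<close>
    also have "\<dots> = fibre_integral Q q (act v g) \<phi>"
      by (simp add: fibre_integral_def q_act v g pullback_act_def)
    also have "\<dots> = (LINT z|bundle_lam Q P q (act v g). \<phi> z)"
      by (rule bundle_lam_integral[OF act_closed[OF v g] \<phi>, symmetric])
    finally show ?thesis .
  qed
  have "snd (\<theta> (pullback_act act z g)) = act (snd (\<theta> z)) g" if "z \<in> topspace E1" "g \<in> carrier G" for z g
    using iso that by (simp add: pullback_bundle_iso_def pullback_act_def)
  then show ?thesis
    unfolding principal_quiver_action_def quiver_action_def bundle_quiver_def quiver.simps
    using action right_action_pullback_act integral principal
    by (auto simp: principal_bundle_def pullback_act_def)
qed

end

section \<open>Orbit spaces of free and proper actions\<close>

lemma openin_prod_topologyE:
  assumes "openin (prod_topology X Y) W" "(x, y) \<in> W"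
  obtains U V where "openin X U" "openin Y V" "x \<in> U" "y \<in> V" "U \<times> V \<subseteq> W"
  using assms unfolding openin_prod_topology_alt by metis

lemma open_map_prod_map:
  assumes f: "open_map X X' f" and g: "open_map Y Y' g"
  shows "open_map (prod_topology X Y) (prod_topology X' Y') (\<lambda>(x, y). (f x, g y))"
  unfolding open_map_def
proof (intro allI impI)
  fix W assume W: "openin (prod_topology X Y) W"
  show "openin (prod_topology X' Y') ((\<lambda>(x, y). (f x, g y)) ` W)"
    unfolding openin_prod_topology_alt
  proof (intro allI impI)
    fix x' y' assume "(x', y') \<in> (\<lambda>(x, y). (f x, g y)) ` W"
    then obtain x y where xy: "(x, y) \<in> W" "x' = f x" "y' = g y" by auto
    obtain U V where UV: "openin X U" "openin Y V" "x \<in> U" "y \<in> V" "U \<times> V \<subseteq> W"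
      by (rule openin_prod_topologyE[OF W xy(1)])
    show "\<exists>U V. openin X' U \<and> openin Y' V \<and> x' \<in> U \<and> y' \<in> V \<and> U \<times> V \<subseteq> (\<lambda>(x, y). (f x, g y)) ` W"
    proof (intro exI conjI)
      show "openin X' (f ` U)" "openin Y' (g ` V)"
        using f g UV by (auto simp: open_map_def)
      have "f ` U \<times> g ` V \<subseteq> (\<lambda>(x, y). (f x, g y)) ` (U \<times> V)" by auto
      also have "\<dots> \<subseteq> (\<lambda>(x, y). (f x, g y)) ` W" using UV(5) by (rule image_mono)
      finally show "f ` U \<times> g ` V \<subseteq> (\<lambda>(x, y). (f x, g y)) ` W" .
    qed (use xy UV in auto)
  qed
qed

text \<open>Distinct points lift to a pair off the closed relation; a box around this pair that
  misses the relation has disjoint images, and these are open.\<close>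

lemma Hausdorff_space_open_map_image:
  assumes p: "open_map X Z p" "p ` topspace X = topspace Z"
    and cl: "closedin (prod_topology X X) {(x, y). x \<in> topspace X \<and> y \<in> topspace X \<and> p x = p y}"
  shows "Hausdorff_space Z"
  unfolding Hausdorff_space_def
proof (intro allI impI, elim conjE)
  fix a b assume ab: "a \<in> topspace Z" "b \<in> topspace Z" "a \<noteq> b"
  let ?R = "{(x, y). x \<in> topspace X \<and> y \<in> topspace X \<and> p x = p y}"
  obtain x y where xy: "x \<in> topspace X" "y \<in> topspace X" "p x = a" "p y = b"
    using ab p(2) by (metis imageE)
  have op: "openin (prod_topology X X) (topspace (prod_topology X X) - ?R)"
    using cl by blast
  have mem: "(x, y) \<in> topspace (prod_topology X X) - ?R"
    using xy ab(3) by simp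
  obtain U V where UV: "openin X U" "openin X V" "x \<in> U" "y \<in> V" "U \<times> V \<subseteq> topspace (prod_topology X X) - ?R"
    by (rule openin_prod_topologyE[OF op mem])
  have "p u \<noteq> p v" if "u \<in> U" "v \<in> V" for u v
  proof -
    have "(u, v) \<in> topspace (prod_topology X X) - ?R"
      using that by (intro subsetD[OF UV(5)] SigmaI)
    then show ?thesis by simp
  qed
  then have "disjnt (p ` U) (p ` V)"
    by (auto simp: disjnt_iff)
  moreover have "openin Z (p ` U)" "openin Z (p ` V)"
    using p(1) UV by (auto simp: open_map_def)
  ultimately show "\<exists>U V. openin Z U \<and> openin Z V \<and> a \<in> U \<and> b \<in> V \<and> disjnt U V"
    using xy UV(3,4) by (intro exI[of _ "p ` U"] exI[of _ "p ` V"]) auto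
qed

section \<open>Topology of orbit spaces\<close>

context topological_action
begin

abbreviation orbits where "orbits \<equiv> orbit_space G X act"
abbreviation orbit where "orbit \<equiv> orbit_of G act"

lemma topspace_orbits: "topspace orbits = orbit ` topspace X"
proof
  show "topspace orbits \<subseteq> orbit ` topspace X"
    using openin_topspace[of orbits] unfolding openin_orbit_space by simp
  have "{x \<in> topspace X. orbit x \<in> orbit ` topspace X} = topspace X" by auto
  then have "openin orbits (orbit ` topspace X)"
    by (simp add: openin_orbit_space)
  then show "orbit ` topspace X \<subseteq> topspace orbits"
    by (rule openin_subset)
qed

lemma continuous_orbit: "continuous_map X orbits orbit"
  unfolding continuous_map_def by (auto simp: topspace_orbits openin_orbit_space)

lemma orbit_eq_iff:
  assumes "x \<in> topspace X" "y \<in> topspace X"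
  shows "orbit x = orbit y \<longleftrightarrow> (\<exists>g\<in>carrier G. y = act x g)"
  using orbit_eqE[OF assms] orbit_act[OF assms(1)] by metis

text \<open>The saturation of an open set is the union of its translates, each open because
  translations are homeomorphisms.\<close>

lemma open_orbit: "open_map X orbits orbit"
  unfolding open_map_def
proof (intro allI impI)
  fix U assume U: "openin X U"
  then have UX: "U \<subseteq> topspace X" by (rule openin_subset)
  have "{x \<in> topspace X. orbit x \<in> orbit ` U} = (\<Union>g\<in>carrier G. (\<lambda>x. act x g) ` U)"
  proof (intro Set.set_eqI iffI)
    fix x assume "x \<in> {x \<in> topspace X. orbit x \<in> orbit ` U}"
    then obtain u where "x \<in> topspace X" "u \<in> U" "orbit u = orbit x" by auto
    then show "x \<in> (\<Union>g\<in>carrier G. (\<lambda>x. act x g) ` U)"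
      using orbit_eq_iff[of u x] UX by auto
  next
    fix x assume "x \<in> (\<Union>g\<in>carrier G. (\<lambda>x. act x g) ` U)"
    then obtain g u where gu: "g \<in> carrier G" "u \<in> U" "x = act u g" by auto
    then have u: "u \<in> topspace X" using UX by auto
    show "x \<in> {x \<in> topspace X. orbit x \<in> orbit ` U}"
      using gu act_closed[OF u gu(1)] orbit_act[OF u gu(1)] by auto
  qed
  also have "openin X \<dots>"
    using U homeomorphic_imp_open_map[OF homeomorphic_translation] by (intro openin_Union) (auto simp: open_map_def)
  finally show "openin orbits (orbit ` U)"
    using UX by (auto simp: openin_orbit_space)
qed

lemma quotient_orbit: "quotient_map X orbits orbit"
  by (rule continuous_open_imp_quotient_map[OF continuous_orbit open_orbit topspace_orbits[symmetric]])

lemma second_countable_orbits: "second_countable X \<Longrightarrow> second_countable orbits"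
  by (rule second_countable_open_map_image[OF continuous_orbit open_orbit topspace_orbits[symmetric]])

lemma locally_compact_orbits: "locally_compact_space X \<Longrightarrow> locally_compact_space orbits"
  by (rule locally_compact_space_continuous_open_map_image[OF continuous_orbit open_orbit topspace_orbits[symmetric]])

end

section \<open>Free and proper actions and the division map\<close>

locale free_proper_action = topological_action G T X act
  for G :: "'g monoid" and T :: "'g topology" and X :: "'x topology" and act +
  assumes free: "free_action G X act" and proper: "proper_action T X act" and X: "lc_Hausdorff X"
begin

lemma act_eq_self: "x \<in> topspace X \<Longrightarrow> g \<in> carrier G \<Longrightarrow> act x g = x \<Longrightarrow> g = \<one>\<^bsub>G\<^esub>"
  using free by (simp add: free_action_def)

lemma act_cancel:
  assumes x: "x \<in> topspace X" and g: "g \<in> carrier G" and h: "h \<in> carrier G" and eq: "act x g = act x h"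
  shows "g = h"
proof -
  interpret group G by (rule G(1))
  have "act x (g \<otimes>\<^bsub>G\<^esub> inv\<^bsub>G\<^esub> h) = x"
    using act_inv[OF x h] act_act[OF x g, of "inv\<^bsub>G\<^esub> h"] h eq by simp
  then have "g \<otimes>\<^bsub>G\<^esub> inv\<^bsub>G\<^esub> h = \<one>\<^bsub>G\<^esub>"
    using g h x by (intro act_eq_self) auto
  then show ?thesis
    using g h by (metis inv_equality inv_inv inv_closed)
qed

abbreviation orbit_relation where
  "orbit_relation \<equiv> {(x, y). x \<in> topspace X \<and> y \<in> topspace X \<and> orbit x = orbit y}"

lemma orbit_relation_eq: "orbit_relation = (\<lambda>(x, g). (x, act x g)) ` topspace (prod_topology X T)"
  by (auto simp: image_iff orbit_eq_iff act_closed G(2) orbit_act)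

lemma closed_orbit_relation: "closedin (prod_topology X X) orbit_relation"
  using proper unfolding proper_action_def orbit_relation_eq
  by (meson proper_imp_closed_map closed_map_def closedin_topspace)

text \<open>The map \<open>(x, g) \<mapsto> (x, act x g)\<close> is continuous, injective by
  freeness and closed by properness, hence a homeomorphism onto the orbit relation.
  \<open>\<delta>\<close> is the group component of its inverse.\<close>

lemma division_map:
  obtains \<delta> where "continuous_map (subtopology (prod_topology X X) orbit_relation) T \<delta>"
    and "\<And>x g. x \<in> topspace X \<Longrightarrow> g \<in> carrier G \<Longrightarrow> \<delta> (x, act x g) = g"
proof -
  let ?f = "\<lambda>(x, g). (x, act x g)"
  let ?Z = "subtopology (prod_topology X X) orbit_relation"
  have image: "?f ` topspace (prod_topology X T) = orbit_relation"
    by (rule orbit_relation_eq[symmetric])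
  then have funcset: "?f \<in> topspace (prod_topology X T) \<rightarrow> orbit_relation"
    by (simp only: image_subset_iff_funcset[symmetric] order_refl)
  have "continuous_map (prod_topology X T) (prod_topology X X) (\<lambda>z. (fst z, act (fst z) (snd z)))"
    by (intro continuous_map_pairedI continuous_map_fst continuous_act continuous_map_snd)
  then have "continuous_map (prod_topology X T) (prod_topology X X) ?f"
    by (simp only: case_prod_unfold)
  then have "continuous_map (prod_topology X T) ?Z ?f"
    by (rule continuous_map_into_subtopology[OF _ funcset])
  moreover have "closed_map (prod_topology X T) ?Z ?f"
    by (rule closed_map_into_subtopology[OF proper_imp_closed_map[OF proper[unfolded proper_action_def]] funcset])
  moreover have "?f ` topspace (prod_topology X T) = topspace ?Z"
  proof -
    have "orbit_relation \<subseteq> topspace (prod_topology X X)" by auto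
    then show ?thesis unfolding image by (simp only: topspace_subtopology Int_absorb1)
  qed
  moreover have "inj_on ?f (topspace (prod_topology X T))"
    by (auto simp: inj_on_def G(2) intro: act_cancel)
  ultimately have "homeomorphic_map (prod_topology X T) ?Z ?f"
    by (rule bijective_closed_imp_homeomorphic_map)
  then obtain h where h: "homeomorphic_maps (prod_topology X T) ?Z ?f h"
    unfolding homeomorphic_map_maps by (rule exE)
  show thesis
  proof
    show "continuous_map ?Z T (\<lambda>z. snd (h z))"
      using continuous_map_compose[OF conjunct1[OF conjunct2[OF h[unfolded homeomorphic_maps_def]]] continuous_map_snd]
      by (simp only: o_def)
    fix x g assume "x \<in> topspace X" "g \<in> carrier G"
    then have "h (?f (x, g)) = (x, g)"
      using h G(2) unfolding homeomorphic_maps_def by simp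
    then show "snd (h (x, act x g)) = g" by simp
  qed
qed

end

section \<open>Equivariant maps into a free and proper space\<close>

text \<open>Serves twice over the same base, with \<open>f\<close> the source and the range map of a
  quiver. Freeness and closed orbits on \<open>Y\<close> are derived from those on \<open>X\<close>
  through \<open>f\<close>.\<close>

locale equivariant_map = base: free_proper_action G T X act + total: topological_action G T Y act'
  for G :: "'g monoid" and T :: "'g topology" and X :: "'x topology" and act
    and Y :: "'y topology" and act' +
  fixes f :: "'y \<Rightarrow> 'x"
  assumes Y: "lc_Hausdorff Y" and f: "continuous_map Y X f"
    and equivariant: "y \<in> topspace Y \<Longrightarrow> g \<in> carrier G \<Longrightarrow> f (act' y g) = act (f y) g"
begin

lemma f_closed: "y \<in> topspace Y \<Longrightarrow> f y \<in> topspace X"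
  using continuous_map_image_subset_topspace[OF f] by blast

text \<open>Orbits are sets of points, so the map that \<open>f\<close> induces between orbit spaces
  can be taken to be direct image, with no choice of representatives.\<close>

lemma image_orbit: "y \<in> topspace Y \<Longrightarrow> f ` total.orbit y = base.orbit (f y)"
  by (auto simp: orbit_of_def equivariant image_image)

lemma continuous_quotient_map: "continuous_map total.orbits base.orbits ((`) f)"
proof -
  have "continuous_map Y base.orbits (base.orbit \<circ> f)"
    by (rule continuous_map_compose[OF f base.continuous_orbit])
  then have "continuous_map Y base.orbits ((`) f \<circ> total.orbit)"
    by (rule continuous_map_eq) (simp add: image_orbit)
  then show ?thesis
    by (rule continuous_compose_quotient_map[OF total.quotient_orbit])
qed

lemma open_quotient_map:
  assumes "open_map Y X f"
  shows "open_map total.orbits base.orbits ((`) f)"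
proof (rule open_map_from_composition_left)
  show "open_map Y base.orbits ((`) f \<circ> total.orbit)"
    using open_map_compose[OF assms base.open_orbit] by (rule open_map_eq) (simp add: image_orbit)
qed (use total.continuous_orbit total.topspace_orbits in auto)

lemma act_eq_self:
  assumes "y \<in> topspace Y" "g \<in> carrier G" "f (act' y g) = f y"
  shows "act' y g = y"
proof -
  have "g = \<one>\<^bsub>G\<^esub>"
    using assms by (intro base.act_eq_self[of "f y"]) (simp_all add: f_closed equivariant)
  then show ?thesis
    using assms(1) by (simp add: total.act_one)
qed

end

context free_proper_action
begin

lemma lc_Hausdorff_orbits: "lc_Hausdorff orbits"
  unfolding lc_Hausdorff_def
proof
  show "locally_compact_space orbits"
    using X by (intro locally_compact_orbits) (simp add: lc_Hausdorff_def)
  show "Hausdorff_space orbits"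
    by (rule Hausdorff_space_open_map_image[OF open_orbit topspace_orbits[symmetric] closed_orbit_relation])
qed

end

context equivariant_map
begin

lemma Hausdorff: "Hausdorff_space Y"
  using Y by (simp add: lc_Hausdorff_def)

text \<open>The group element carrying \<open>y\<close> to \<open>y'\<close> is read off continuously from \<open>f y\<close> and \<open>f y'\<close> by
  the division map of \<open>X\<close>.\<close>

lemma closed_total_relation:
  "closedin (prod_topology Y Y) {(x, y). x \<in> topspace Y \<and> y \<in> topspace Y \<and> total.orbit x = total.orbit y}"
proof -
  let ?YY = "prod_topology Y Y" and ?XX = "prod_topology X X"
  obtain \<delta> where \<delta>: "continuous_map (subtopology ?XX base.orbit_relation) T \<delta>"
    "\<And>x g. x \<in> topspace X \<Longrightarrow> g \<in> carrier G \<Longrightarrow> \<delta> (x, act x g) = g"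
    by (rule base.division_map) (rule that)
  let ?ff = "\<lambda>z. (f (fst z), f (snd z))"
  have ff: "continuous_map ?YY ?XX ?ff"
    using continuous_map_compose[OF continuous_map_fst f] continuous_map_compose[OF continuous_map_snd f]
    by (intro continuous_map_pairedI) (simp_all only: o_def)
  define D where "D = {z \<in> topspace ?YY. ?ff z \<in> base.orbit_relation}"
  have D: "closedin ?YY D"
    unfolding D_def by (rule closedin_continuous_map_preimage[OF ff base.closed_orbit_relation])
  let ?D = "subtopology ?YY D"
  have "continuous_map ?D (subtopology ?XX base.orbit_relation) ?ff"
  proof (rule continuous_map_into_subtopology)
    show "continuous_map ?D ?XX ?ff" by (rule continuous_map_from_subtopology[OF ff])
    show "?ff \<in> topspace ?D \<rightarrow> base.orbit_relation" unfolding D_def by auto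
  qed
  then have d: "continuous_map ?D T (\<lambda>z. \<delta> (?ff z))"
    using continuous_map_compose[OF _ \<delta>(1)] by (simp only: o_def)
  have fst: "continuous_map ?D Y fst" and snd: "continuous_map ?D Y snd"
    by (simp_all add: continuous_map_from_subtopology continuous_map_fst continuous_map_snd)
  have a: "continuous_map ?D Y (\<lambda>z. act' (fst z) (\<delta> (?ff z)))"
    by (rule total.continuous_act[OF fst d])
  \<comment> \<open>Over \<open>D\<close> there is a single candidate for the group element. Lying
    in one orbit then becomes an equation between two continuous maps into the Hausdorff space
    \<open>Y\<close>, which cuts out a closed set.\<close>
  have "closedin ?D {z \<in> topspace ?D. act' (fst z) (\<delta> (?ff z)) = snd z}"
    by (rule closedin_continuous_maps_eq[OF Hausdorff a snd])
  then have closed: "closedin ?YY {z \<in> topspace ?D. act' (fst z) (\<delta> (?ff z)) = snd z}"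
    using D by (rule closedin_trans_full)
  have "{z \<in> topspace ?D. act' (fst z) (\<delta> (?ff z)) = snd z}
      = {(x, y). x \<in> topspace Y \<and> y \<in> topspace Y \<and> total.orbit x = total.orbit y}" (is "?L = ?R")
  proof (intro subset_antisym subsetI)
    fix z assume z: "z \<in> ?L"
    then have "z \<in> topspace ?D" by blast
    then have "\<delta> (?ff z) \<in> carrier G"
      using continuous_map_image_subset_topspace[OF d] total.G(2) by auto
    moreover have fz: "fst z \<in> topspace Y" and sz: "act' (fst z) (\<delta> (?ff z)) = snd z"
      using z by auto
    ultimately have "snd z \<in> topspace Y" "total.orbit (snd z) = total.orbit (fst z)"
      using total.act_closed[of "fst z" "\<delta> (?ff z)"] total.orbit_act[of "fst z" "\<delta> (?ff z)"]
      unfolding sz by simp_all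
    with fz show "z \<in> ?R" by (simp add: case_prod_unfold)
  next
    fix z assume "z \<in> ?R"
    then obtain x y where z: "z = (x, y)" "x \<in> topspace Y" "y \<in> topspace Y" "total.orbit x = total.orbit y" by auto
    obtain g where g: "g \<in> carrier G" "y = act' x g"
      by (rule total.orbit_eqE[OF z(2-4)])
    have "f y = act (f x) g" using g z(2) by (simp add: equivariant)
    then show "z \<in> ?L"
      using z g by (simp add: D_def f_closed base.orbit_act base.act_closed \<delta>(2))
  qed
  with closed show ?thesis by (simp only:)
qed

lemma lc_Hausdorff_total_orbits: "lc_Hausdorff total.orbits"
  unfolding lc_Hausdorff_def
proof
  show "locally_compact_space total.orbits"
    using Y by (intro total.locally_compact_orbits) (simp add: lc_Hausdorff_def)
  show "Hausdorff_space total.orbits"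
    by (rule Hausdorff_space_open_map_image[OF total.open_orbit total.topspace_orbits[symmetric] closed_total_relation])
qed

abbreviation total_pullback where
  "total_pullback \<equiv> pullback total.orbits ((`) f) X base.orbit"

lemma continuous_into_total_pullback:
  "continuous_map Y total_pullback (\<lambda>y. (total.orbit y, f y))"
  by (intro continuous_map_into_pullback total.continuous_orbit f image_orbit)

text \<open>Two points of one orbit with the same image under \<open>f\<close> differ by an element
  that fixes this image, hence by the unit.\<close>

lemma inj_on_into_total_pullback: "inj_on (\<lambda>y. (total.orbit y, f y)) (topspace Y)"
proof (rule inj_onI)
  fix x y assume xy: "x \<in> topspace Y" "y \<in> topspace Y" "(total.orbit x, f x) = (total.orbit y, f y)"
  then obtain g where "g \<in> carrier G" "y = act' x g"
    using total.orbit_eq_iff by auto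
  then show "x = y"
    using xy act_eq_self[of x g] by simp
qed

text \<open>A point of the pullback is an orbit \<open>[y]\<close> and an \<open>x\<close> in the
  orbit of \<open>f y\<close>; translating \<open>y\<close> by the element that moves
  \<open>f y\<close> to \<open>x\<close> gives its preimage.\<close>

lemma image_into_total_pullback:
  "(\<lambda>y. (total.orbit y, f y)) ` topspace Y = topspace total_pullback"
proof (intro subset_antisym subsetI)
  fix z assume "z \<in> (\<lambda>y. (total.orbit y, f y)) ` topspace Y"
  then show "z \<in> topspace total_pullback"
    by (elim imageE) (simp add: topspace_pullback total.topspace_orbits f_closed image_orbit)
next
  fix z assume "z \<in> topspace total_pullback"
  then obtain y x where z: "z = (total.orbit y, x)" "y \<in> topspace Y" "x \<in> topspace X" "base.orbit (f y) = base.orbit x"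
    by (auto simp: topspace_pullback total.topspace_orbits image_orbit)
  obtain g where "g \<in> carrier G" "x = act (f y) g"
    by (rule base.orbit_eqE[OF f_closed[OF z(2)] z(3,4)])
  then show "z \<in> (\<lambda>y. (total.orbit y, f y)) ` topspace Y"
    using z by (intro image_eqI[of _ _ "act' y g"]) (simp_all add: total.orbit_act total.act_closed equivariant)
qed

text \<open>The inverse is continuous before passing to orbits: on pairs \<open>(y, x)\<close> with
  \<open>f y\<close> and \<open>x\<close> in one orbit it is
  \<open>(y, x) \<mapsto> act' y (\<delta> (f y, x))\<close>. Passing from \<open>y\<close> to its
  orbit is an open map, so openness survives the quotient.\<close>

lemma open_map_into_total_pullback:
  "open_map Y total_pullback (\<lambda>y. (total.orbit y, f y))"
  unfolding open_map_def
proof (intro allI impI)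
  fix U assume U: "openin Y U"
  let ?YX = "prod_topology Y X" and ?XX = "prod_topology X X"
  obtain \<delta> where \<delta>: "continuous_map (subtopology ?XX base.orbit_relation) T \<delta>"
    "\<And>x g. x \<in> topspace X \<Longrightarrow> g \<in> carrier G \<Longrightarrow> \<delta> (x, act x g) = g"
    by (rule base.division_map) (rule that)
  define W where "W = {z \<in> topspace ?YX. base.orbit (f (fst z)) = base.orbit (snd z)}"
  let ?W = "subtopology ?YX W"
  let ?ff = "\<lambda>z. (f (fst z), snd z)"
  have "continuous_map ?YX ?XX ?ff"
    using continuous_map_compose[OF continuous_map_fst f]
    by (intro continuous_map_pairedI continuous_map_snd) (simp only: o_def)
  then have "continuous_map ?W (subtopology ?XX base.orbit_relation) ?ff"
    by (intro continuous_map_into_subtopology continuous_map_from_subtopology)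
      (auto simp: W_def f_closed)
  then have d: "continuous_map ?W T (\<lambda>z. \<delta> (?ff z))"
    using continuous_map_compose[OF _ \<delta>(1)] by (simp only: o_def)
  have a: "continuous_map ?W Y (\<lambda>z. act' (fst z) (\<delta> (?ff z)))"
    by (intro total.continuous_act[OF _ d] continuous_map_from_subtopology continuous_map_fst)
  let ?\<rho> = "\<lambda>(y, x). (total.orbit y, x)"
  have "open_map ?YX (prod_topology total.orbits X) ?\<rho>"
    by (rule open_map_prod_map[OF total.open_orbit, of X X "\<lambda>x. x"]) (simp add: open_map_def)
  \<comment> \<open>Restricting an open map keeps it open here because \<open>W\<close> is the full
    preimage of the pullback.\<close>
  then have "open_map ?W total_pullback ?\<rho>"
    unfolding pullback_def
    by (rule open_map_restriction)
      (rule Set.set_eqI, simp add: W_def case_prod_unfold mem_Times_iff total.topspace_orbits image_orbit cong: conj_cong)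
  moreover have "openin ?W {z \<in> topspace ?W. act' (fst z) (\<delta> (?ff z)) \<in> U}"
    by (rule openin_continuous_map_preimage[OF a U])
  ultimately have "openin total_pullback (?\<rho> ` {z \<in> topspace ?W. act' (fst z) (\<delta> (?ff z)) \<in> U})"
    by (simp only: open_map_def)
  \<comment> \<open>From left to right, \<open>y\<close> is moved within its orbit until it lies
    over \<open>x\<close>. From right to left, the pair \<open>(y, f y)\<close> works, since there
    \<open>\<delta>\<close> is the unit.\<close>
  moreover have "?\<rho> ` {z \<in> topspace ?W. act' (fst z) (\<delta> (?ff z)) \<in> U} = (\<lambda>y. (total.orbit y, f y)) ` U"
    (is "?L = ?R")
  proof (intro subset_antisym subsetI)
    fix w assume "w \<in> ?L"
    then obtain y x where w: "w = (total.orbit y, x)" "y \<in> topspace Y" "x \<in> topspace X"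
      "base.orbit (f y) = base.orbit x" "act' y (\<delta> (f y, x)) \<in> U"
      by (auto simp: W_def)
    obtain g where g: "g \<in> carrier G" "x = act (f y) g"
      by (rule base.orbit_eqE[OF f_closed[OF w(2)] w(3,4)])
    then have "act' y g \<in> U"
      using w(2,5) by (simp add: \<delta>(2) f_closed)
    then show "w \<in> ?R"
      using w g by (intro image_eqI[of _ _ "act' y g"]) (simp_all add: total.orbit_act equivariant)
  next
    fix w assume "w \<in> ?R"
    then obtain y where y: "y \<in> U" "w = (total.orbit y, f y)" by blast
    then have yY: "y \<in> topspace Y" using openin_subset[OF U] by blast
    have "\<delta> (f y, f y) = \<one>\<^bsub>G\<^esub>"
      using \<delta>(2)[OF f_closed[OF yY] total.G(3)] by (simp add: base.act_one f_closed yY)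
    then have "(y, f y) \<in> {z \<in> topspace ?W. act' (fst z) (\<delta> (?ff z)) \<in> U}"
      using y(1) yY by (simp add: W_def f_closed total.act_one)
    then show "w \<in> ?L"
      by (rule rev_image_eqI) (simp add: y(2))
  qed
  ultimately show "openin total_pullback ((\<lambda>y. (total.orbit y, f y)) ` U)"
    by (simp only:)
qed

lemma homeomorphic_into_total_pullback:
  "homeomorphic_map Y total_pullback (\<lambda>y. (total.orbit y, f y))"
  by (rule bijective_open_imp_homeomorphic_map[OF continuous_into_total_pullback
        open_map_into_total_pullback image_into_total_pullback inj_on_into_total_pullback])

end

section \<open>The quotient of a quiver by a principal action\<close>

locale principal_quiver =
  fixes G :: "'g monoid" and T :: "'g topology" and R :: "('v, 'e) quiver" and act0 act1
  assumes group: "lc_group G T" and R: "topological_quiver R"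
    and principal: "principal_quiver_action G T R act0 act1"

sublocale principal_quiver \<subseteq> source: equivariant_map G T "verts R" act0 "edges R" act1 "src R"
  using group principal topological_quiverD[OF R]
  by unfold_locales (simp_all add: principal_quiver_action_def quiver_action_def)

sublocale principal_quiver \<subseteq> range: equivariant_map G T "verts R" act0 "edges R" act1 "rng R"
  using group principal topological_quiverD[OF R]
  by unfold_locales (simp_all add: principal_quiver_action_def quiver_action_def)

context principal_quiver
begin

lemmas R' = topological_quiverD[OF R]

abbreviation "\<pi>0 \<equiv> orbit_of G act0"
abbreviation "\<pi>1 \<equiv> orbit_of G act1"
abbreviation "F0 \<equiv> orbit_space G (verts R) act0"
abbreviation "F1 \<equiv> orbit_space G (edges R) act1"
abbreviation fibre where "fibre v \<equiv> {e \<in> topspace (edges R). src R e = v}"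
abbreviation "src_pullback \<equiv> pullback F1 ((`) (src R)) (verts R) \<pi>0"
abbreviation "rng_pullback \<equiv> pullback F1 ((`) (rng R)) (verts R) \<pi>0"
abbreviation j where "j e \<equiv> (\<pi>1 e, src R e)"

lemma Hausdorff_F0: "Hausdorff_space F0" and Hausdorff_F1: "Hausdorff_space F1"
  using source.base.lc_Hausdorff_orbits source.lc_Hausdorff_total_orbits by (simp_all add: lc_Hausdorff_def)

text \<open>The action axiom gives equality of integrals over \<open>Cc\<close> only. Both sides are
  Radon measures, so uniqueness turns it into an equality of measures.\<close>

lemma lam_act:
  assumes v: "v \<in> topspace (verts R)" and g: "g \<in> carrier G"
  shows "lam R (act0 v g) = distr (lam R v) (borel_of (edges R)) (\<lambda>e. act1 e g)"
proof -
  note cont_g = source.total.continuous_translation[OF g]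
  have sets: "sets (lam R v) = sets (borel_of (edges R))"
    by (rule radon_measureD(2)[OF R'(10)[OF v]])
  \<comment> \<open>Here the closed set of full measure is the whole carrier, and translation is
    proper because it is a homeomorphism.\<close>
  interpret radon_pushforward "edges R" "lam R v" "topspace (edges R)" "edges R" "\<lambda>e. act1 e g"
    using cont_g homeomorphic_imp_proper_map[OF source.total.homeomorphic_translation[OF g]] R' v
    by unfold_locales auto
  have "radon_measure (edges R) (distr (lam R v) (borel_of (edges R)) (\<lambda>e. act1 e g))"
    using radon unfolding pushforward_eq_distr[OF cont_g] .
  then show ?thesis
  proof (rule radon_measure_eqI[OF R'(3) R'(10)[OF source.base.act_closed[OF v g]]])
    fix \<phi> assume \<phi>: "\<phi> \<in> Cc (edges R)"
    have "(LINT e|lam R v. \<phi> (act1 e g)) = (LINT e|lam R (act0 v g). \<phi> e)"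
      using principal \<phi> v g by (simp add: principal_quiver_action_def quiver_action_def)
    moreover have "(LINT e|distr (lam R v) (borel_of (edges R)) (\<lambda>e. act1 e g). \<phi> e) = (LINT e|lam R v. \<phi> (act1 e g))"
      by (intro integral_distr continuous_map_measurable_borel_of[OF sets cont_g]
          continuous_map_borel_measurable[OF refl Cc_continuous_map[OF \<phi>]])
    ultimately show "(LINT e|lam R (act0 v g). \<phi> e) = (LINT e|distr (lam R v) (borel_of (edges R)) (\<lambda>e. act1 e g). \<phi> e)"
      by simp
  qed
qed

text \<open>The chosen representative is immaterial by \<open>quotient_lam_eq\<close>; the choice
  only makes the measure a function of the orbit.\<close>

definition quotient_lam :: "'v set \<Rightarrow> 'e set measure" where
  "quotient_lam c = distr (lam R (SOME v. v \<in> topspace (verts R) \<and> \<pi>0 v = c)) (borel_of F1) \<pi>1"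

definition quotient_quiver :: "('v set, 'e set) quiver" where
  "quotient_quiver = \<lparr>verts = F0, edges = F1, rng = (`) (rng R), src = (`) (src R), lam = quotient_lam\<rparr>"

text \<open>Two representatives differ by some \<open>g\<close>, so their measures differ by
  translation by \<open>g\<close>, and \<open>\<pi>1\<close> is unchanged when composed with that
  translation.\<close>

lemma quotient_lam_eq:
  assumes v: "v \<in> topspace (verts R)"
  shows "quotient_lam (\<pi>0 v) = distr (lam R v) (borel_of F1) \<pi>1"
proof -
  define w where "w = (SOME w. w \<in> topspace (verts R) \<and> \<pi>0 w = \<pi>0 v)"
  have w: "w \<in> topspace (verts R) \<and> \<pi>0 w = \<pi>0 v"
    unfolding w_def by (rule someI[of _ v]) (simp add: v)
  then obtain g where g: "g \<in> carrier G" "w = act0 v g"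
    using source.base.orbit_eq_iff[OF v, of w] by auto
  have sets: "sets (lam R v) = sets (borel_of (edges R))"
    by (rule radon_measureD(2)[OF R'(10)[OF v]])
  have space: "space (lam R v) = topspace (edges R)"
    by (rule radon_measureD(1)[OF R'(10)[OF v]])
  have "quotient_lam (\<pi>0 v) = distr (lam R w) (borel_of F1) \<pi>1"
    by (simp add: quotient_lam_def w_def)
  also have "\<dots> = distr (lam R v) (borel_of F1) (\<pi>1 \<circ> (\<lambda>e. act1 e g))"
    unfolding g(2) lam_act[OF v g(1)]
    by (intro distr_distr continuous_map_measurable_borel_of[OF refl source.total.continuous_orbit]
        continuous_map_measurable_borel_of[OF sets source.total.continuous_translation[OF g(1)]])
  also have "\<dots> = distr (lam R v) (borel_of F1) \<pi>1"
    using source.total.orbit_act[OF _ g(1)] by (intro distr_cong refl) (simp add: space)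
  finally show ?thesis .
qed

text \<open>Identifies the support of the quotient measure with a fibre of the induced source map.
  The nontrivial inclusion is surjectivity of \<open>j\<close>: a pair \<open>(c, v)\<close> in the
  pullback comes from an edge whose source is exactly \<open>v\<close>.\<close>

lemma orbit_fibre:
  assumes v: "v \<in> topspace (verts R)"
  shows "\<pi>1 ` fibre v = {c \<in> topspace F1. src R ` c = \<pi>0 v}"
proof (intro subset_antisym subsetI)
  fix c assume "c \<in> \<pi>1 ` fibre v"
  then show "c \<in> {c \<in> topspace F1. src R ` c = \<pi>0 v}"
    by (elim imageE) (simp add: source.total.topspace_orbits source.image_orbit)
next
  fix c assume "c \<in> {c \<in> topspace F1. src R ` c = \<pi>0 v}"
  then have "(c, v) \<in> topspace src_pullback"
    using v by (simp add: topspace_pullback)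
  then show "c \<in> \<pi>1 ` fibre v"
    unfolding source.image_into_total_pullback[symmetric] by auto
qed

lemma closed_src_pullback:
  "closedin (prod_topology F1 (verts R)) {(c, v). c \<in> topspace F1 \<and> v \<in> topspace (verts R) \<and> src R ` c = \<pi>0 v}"
  by (rule closedin_pullback[OF source.continuous_quotient_map source.base.continuous_orbit Hausdorff_F0])

lemma closedin_fibre_src: "v \<in> topspace (verts R) \<Longrightarrow> closedin (edges R) (fibre v)"
  by (rule closedin_fibre[OF R'(8,5)])

text \<open>On all edges the orbit map need not be closed or injective, so the fibre is studied
  through \<open>j\<close>. Injectivity is that of \<open>j\<close>, whose second component is
  constant on the fibre; closedness is read off from slices of closed sets in the product.\<close>

lemma radon_pushforward_orbit:
  assumes v: "v \<in> topspace (verts R)"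
  shows "radon_pushforward (edges R) (lam R v) (fibre v) F1 \<pi>1"
proof
  show "continuous_map (subtopology (edges R) (fibre v)) F1 \<pi>1"
    by (rule continuous_map_from_subtopology[OF source.total.continuous_orbit])
  show "proper_map (subtopology (edges R) (fibre v)) F1 \<pi>1"
  proof (rule closed_injective_imp_proper_map)
    show "inj_on \<pi>1 (topspace (subtopology (edges R) (fibre v)))"
    proof (rule inj_onI)
      fix x y assume "x \<in> topspace (subtopology (edges R) (fibre v))"
        "y \<in> topspace (subtopology (edges R) (fibre v))" "\<pi>1 x = \<pi>1 y"
      then show "x = y"
        by (intro inj_onD[OF source.inj_on_into_total_pullback, of x y]) auto
    qed
    show "closed_map (subtopology (edges R) (fibre v)) F1 \<pi>1"
      unfolding closed_map_def
    proof (intro allI impI)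
      fix D assume "closedin (subtopology (edges R) (fibre v)) D"
      then have D: "closedin (edges R) D" "D \<subseteq> fibre v"
        by (simp_all add: closedin_closed_subtopology[OF closedin_fibre_src[OF v]])
      have "closedin src_pullback (j ` D)"
        using homeomorphic_imp_closed_map[OF source.homeomorphic_into_total_pullback] D(1)
        by (simp only: closed_map_def)
      then have jD: "closedin (prod_topology F1 (verts R)) (j ` D)"
        using closed_src_pullback unfolding pullback_def by (rule closedin_trans_full)
      \<comment> \<open>The \<open>j\<close>-image of \<open>D\<close> is closed in the product and
        lies over \<open>v\<close> alone, so its slice at \<open>v\<close> is the orbit image of
        \<open>D\<close>.\<close>
      have "continuous_map F1 (prod_topology F1 (verts R)) (\<lambda>c. (c, v))"
        using v by (simp add: continuous_map_paired)
      then have "closedin F1 {c \<in> topspace F1. (c, v) \<in> j ` D}"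
        using jD by (rule closedin_continuous_map_preimage)
      moreover have "{c \<in> topspace F1. (c, v) \<in> j ` D} = \<pi>1 ` D"
        using D(2) closedin_subset[OF D(1)] by (auto simp: source.total.topspace_orbits)
      ultimately show "closedin F1 (\<pi>1 ` D)" by simp
    qed
  qed
qed (use R' v Hausdorff_F1 closedin_fibre_src[OF v] lam_null_off_fibre[OF R v] in auto)

lemma continuous_map_scaleR_product:
  fixes \<xi> :: "'e set \<Rightarrow> 'b::real_normed_vector"
  assumes \<kappa>: "continuous_map (verts R) euclideanreal \<kappa>" and \<xi>: "continuous_map F1 euclidean \<xi>"
  shows "continuous_map (edges R) euclidean (\<lambda>e. \<kappa> (src R e) *\<^sub>R \<xi> (\<pi>1 e))"
  using continuous_map_compose[OF R'(8) \<kappa>] continuous_map_compose[OF source.total.continuous_orbit \<xi>]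
  unfolding o_def by (rule continuous_map_scaleR)

text \<open>The pullback of \<open>\<xi>\<close> to the edges of \<open>R\<close> is not compactly supported, but its product with a
  cutoff function on the vertices is, because the edges embed as a closed subset of \<open>F1 \<times> verts R\<close>.\<close>

lemma scaleR_cutoff_in_Cc:
  assumes \<kappa>: "(\<lambda>v. complex_of_real (\<kappa> v)) \<in> Cc (verts R)" "continuous_map (verts R) euclideanreal \<kappa>"
    and \<xi>: "\<xi> \<in> Cc F1"
  shows "(\<lambda>e. \<kappa> (src R e) *\<^sub>R \<xi> (\<pi>1 e)) \<in> Cc (edges R)"
proof -
  obtain L where L: "compactin (verts R) L" "\<And>v. v \<in> topspace (verts R) \<Longrightarrow> v \<notin> L \<Longrightarrow> complex_of_real (\<kappa> v) = 0"
    by (rule CcE[OF \<kappa>(1)]) (rule that)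
  obtain K where K: "compactin F1 K" "\<And>c. c \<in> topspace F1 \<Longrightarrow> c \<notin> K \<Longrightarrow> \<xi> c = 0"
    by (rule CcE[OF \<xi>]) (rule that)
  let ?S = "{(c, v). c \<in> topspace F1 \<and> v \<in> topspace (verts R) \<and> src R ` c = \<pi>0 v}"
  have "compactin (prod_topology F1 (verts R)) (K \<times> L)"
    using K(1) L(1) by (simp add: compactin_Times)
  then have "compactin (prod_topology F1 (verts R)) (?S \<inter> K \<times> L)"
    by (rule closed_Int_compactin[OF closed_src_pullback])
  then have "compactin src_pullback (?S \<inter> K \<times> L)"
    unfolding pullback_def by (simp add: compactin_subtopology)
  then have compact: "compactin (edges R) {e \<in> topspace (edges R). j e \<in> ?S \<inter> K \<times> L}"
    by (rule compactin_proper_map_preimage[OF homeomorphic_imp_proper_map[OF source.homeomorphic_into_total_pullback]])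
  show ?thesis
  proof (rule CcI[OF R'(6) continuous_map_scaleR_product[OF \<kappa>(2) Cc_continuous_map[OF \<xi>]] compact])
    fix e assume e: "e \<in> topspace (edges R)" "e \<notin> {e \<in> topspace (edges R). j e \<in> ?S \<inter> K \<times> L}"
    then have "j e \<in> ?S"
      by (simp add: source.total.topspace_orbits source.image_orbit source.f_closed)
    with e have "src R e \<notin> L \<or> \<pi>1 e \<notin> K" by auto
    then show "\<kappa> (src R e) *\<^sub>R \<xi> (\<pi>1 e) = 0"
      using L(2)[of "src R e"] K(2)[of "\<pi>1 e"] e(1) by (auto simp: source.f_closed source.total.topspace_orbits)
  qed
qed

text \<open>Continuity is checked on \<open>verts R\<close> and descends along the quotient map
  \<open>\<pi>0\<close>. Being local there, it allows a separate cutoff near each \<open>v0\<close>,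
  which replaces the lifted function by one of compact support without changing its integrals near
  \<open>v0\<close>.\<close>

lemma quotient_lam_continuous:
  assumes \<xi>: "\<xi> \<in> Cc F1"
  shows "continuous_map F0 euclidean (\<lambda>c. LINT x|quotient_lam c. \<xi> x)"
proof -
  define h where "h v = (LINT e|lam R v. \<xi> (\<pi>1 e))" for v
  have \<xi>c: "continuous_map F1 euclidean \<xi>" by (rule Cc_continuous_map[OF \<xi>])
  have h: "continuous_map (verts R) euclidean h"
    unfolding continuous_map_euclidean_iff
  proof (intro ballI allI impI)
    fix v0 and \<epsilon> :: real assume v0: "v0 \<in> topspace (verts R)" and \<epsilon>: "\<epsilon> > 0"
    have "\<exists>V L. openin (verts R) V \<and> compactin (verts R) L \<and> v0 \<in> V \<and> V \<subseteq> L"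
      using R'(1) v0 by (simp add: lc_Hausdorff_def locally_compact_space_def)
    then obtain V L where V: "openin (verts R) V" "compactin (verts R) L" "v0 \<in> V" "V \<subseteq> L"
      by (elim exE conjE) (rule that)
    obtain \<kappa> :: "_ \<Rightarrow> real" where \<kappa>: "continuous_map (verts R) euclidean \<kappa>"
      "\<And>e. 0 \<le> \<kappa> e" "\<And>e. \<kappa> e \<le> 1" "\<And>e. e \<in> L \<Longrightarrow> \<kappa> e = 1"
      "\<And>e. e \<notin> topspace (verts R) \<Longrightarrow> \<kappa> e = 0" "(\<lambda>e. complex_of_real (\<kappa> e)) \<in> Cc (verts R)"
      by (rule Cc_Urysohn[OF R'(1) V(2) openin_topspace compactin_subset_topspace[OF V(2)]]) (rule that)
    define h' where "h' v = (LINT e|lam R v. \<kappa> (src R e) *\<^sub>R \<xi> (\<pi>1 e))" for v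
    have h': "continuous_map (verts R) euclidean h'"
      unfolding h'_def by (rule R'(13)[OF scaleR_cutoff_in_Cc[OF \<kappa>(6,1) \<xi>]])
    have eq: "h' v = h v" if "v \<in> V" for v
    proof -
      have v: "v \<in> topspace (verts R)" using that openin_subset[OF V(1)] by blast
      interpret radon_pushforward "edges R" "lam R v" "fibre v" F1 \<pi>1
        by (rule radon_pushforward_orbit[OF v])
      have m1: "(\<lambda>e. \<kappa> (src R e) *\<^sub>R \<xi> (\<pi>1 e)) \<in> borel_measurable (lam R v)"
        by (rule continuous_map_borel_measurable[OF sets_M continuous_map_scaleR_product[OF \<kappa>(1) \<xi>c]])
      have m2: "(\<lambda>e. \<xi> (\<pi>1 e)) \<in> borel_measurable (lam R v)"
        using continuous_map_borel_measurable[OF sets_M continuous_map_compose[OF source.total.continuous_orbit \<xi>c]]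
        by (simp only: o_def)
      \<comment> \<open>On the fibre of \<open>v\<close>, which carries all the mass, the factor
        \<open>\<kappa> (src R e)\<close> is the constant \<open>\<kappa> v\<close>.\<close>
      have "\<kappa> v = 1" using \<kappa>(4) V(4) that by blast
      then have "(LINT e:fibre v|lam R v. \<kappa> (src R e) *\<^sub>R \<xi> (\<pi>1 e)) = (LINT e:fibre v|lam R v. \<xi> (\<pi>1 e))"
        unfolding set_lebesgue_integral_def
        by (intro Bochner_Integration.integral_cong refl) (simp add: indicator_def)
      then show ?thesis
        unfolding h_def h'_def set_integral_C[OF m1] set_integral_C[OF m2] .
    qed
    obtain U where U: "openin (verts R) U" "v0 \<in> U" "\<forall>v\<in>U. dist (h' v0) (h' v) < \<epsilon>"
      using h'[unfolded continuous_map_euclidean_iff, rule_format, OF v0 \<epsilon>] by (elim exE conjE) (rule that)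
    show "\<exists>U. openin (verts R) U \<and> v0 \<in> U \<and> (\<forall>v\<in>U. dist (h v0) (h v) < \<epsilon>)"
    proof (intro exI conjI ballI)
      show "openin (verts R) (U \<inter> V)" "v0 \<in> U \<inter> V" using U V by auto
      show "dist (h v0) (h v) < \<epsilon>" if "v \<in> U \<inter> V" for v
        using U(3) that eq[of v] eq[OF V(3)] by auto
    qed
  qed
  have "(LINT x|quotient_lam (\<pi>0 v). \<xi> x) = h v" if v: "v \<in> topspace (verts R)" for v
    unfolding quotient_lam_eq[OF v] h_def
    by (intro integral_distr continuous_map_borel_measurable[OF refl \<xi>c]
        continuous_map_measurable_borel_of[OF radon_measureD(2)[OF R'(10)[OF v]] source.total.continuous_orbit])
  then have "continuous_map (verts R) euclidean ((\<lambda>c. LINT x|quotient_lam c. \<xi> x) \<circ> \<pi>0)"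
    by (intro continuous_map_eq[OF h]) simp
  then show ?thesis
    by (rule continuous_compose_quotient_map[OF source.base.quotient_orbit])
qed

lemma topological_quiver_quotient: "topological_quiver quotient_quiver"
proof -
  have lam: "radon_measure F1 (quotient_lam c) \<and> emeasure (quotient_lam c) (topspace F1) \<noteq> 0 \<and>
      measure_supp F1 (quotient_lam c) = {x \<in> topspace F1. src R ` x = c}" if c: "c \<in> topspace F0" for c
  proof -
    obtain v where v: "v \<in> topspace (verts R)" "c = \<pi>0 v"
      using c unfolding source.base.topspace_orbits by (elim imageE) (rule that)
    interpret radon_pushforward "edges R" "lam R v" "fibre v" F1 \<pi>1
      by (rule radon_pushforward_orbit[OF v(1)])
    show ?thesis
      unfolding v(2) quotient_lam_eq[OF v(1)] pushforward_eq_distr[OF source.total.continuous_orbit, symmetric]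
      using radon emeasure_topspace measure_supp_eq R'(11,12)[OF v(1)] orbit_fibre[OF v(1)] by simp
  qed
  show ?thesis
    unfolding topological_quiver_def quotient_quiver_def quiver.simps
    using source.base.lc_Hausdorff_orbits source.base.second_countable_orbits[OF R'(2)]
      source.lc_Hausdorff_total_orbits source.total.second_countable_orbits[OF R'(4)]
      source.continuous_quotient_map range.continuous_quotient_map source.open_quotient_map[OF R'(9)]
      lam quotient_lam_continuous by simp
qed

lemma principal_bundle_quotient: "principal_bundle G T (verts R) act0 F0 \<pi>0"
  unfolding principal_bundle_def
proof (intro conjI exI[of _ id] ballI)
  show "homeomorphic_map F0 F0 id" by simp
qed (use R' source.base.action source.base.free source.base.proper source.base.lc_Hausdorff_orbits
    source.base.continuous_orbit source.base.topspace_orbits in auto)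

text \<open>\<open>\<theta>\<close> is the inverse of \<open>j\<close> followed by the corresponding
  map for \<open>rng R\<close>. It lies over the identity of \<open>F1\<close> because both maps
  begin with the orbit, and the second component of \<open>\<theta> (j e)\<close> is
  \<open>rng R e\<close>. So \<open>j\<close> on edges and the identity on vertices respect source
  and range, which leaves the measures to compare.\<close>

lemma isomorphic_bundle_quiver:
  obtains \<theta> where "pullback_bundle_iso G F1 (verts R) act0 \<pi>0 ((`) (src R)) ((`) (rng R)) \<theta>"
    and "isomorphic_quivers R (bundle_quiver quotient_quiver (verts R) \<pi>0 \<theta>)"
proof -
  let ?k = "\<lambda>e. (\<pi>1 e, rng R e)"
  obtain i where i: "homeomorphic_maps (edges R) src_pullback j i"
    using source.homeomorphic_into_total_pullback unfolding homeomorphic_map_maps by (rule exE)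
  have ij: "i (j e) = e" if "e \<in> topspace (edges R)" for e
    using i that by (simp add: homeomorphic_maps_def)
  define \<theta> where "\<theta> = ?k \<circ> i"
  have \<theta>j: "\<theta> (j e) = ?k e" if "e \<in> topspace (edges R)" for e
    using that by (simp add: \<theta>_def ij)
  have jE: "\<exists>e\<in>topspace (edges R). z = j e" if "z \<in> topspace src_pullback" for z
    using that unfolding source.image_into_total_pullback[symmetric] by blast
  have iso: "pullback_bundle_iso G F1 (verts R) act0 \<pi>0 ((`) (src R)) ((`) (rng R)) \<theta>"
    unfolding pullback_bundle_iso_def
  proof (intro conjI ballI)
    have "homeomorphic_map src_pullback (edges R) i"
      using i homeomorphic_maps_sym homeomorphic_maps_imp_map by metis
    then show "homeomorphic_map src_pullback rng_pullback \<theta>"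
      unfolding \<theta>_def by (rule homeomorphic_map_compose[OF _ range.homeomorphic_into_total_pullback])
  next
    fix z assume "z \<in> topspace src_pullback"
    then obtain e where "e \<in> topspace (edges R)" "z = j e" using jE by blast
    then show "fst (\<theta> z) = fst z" by (simp add: \<theta>j)
  next
    fix z g assume "z \<in> topspace src_pullback" and g: "g \<in> carrier G"
    then obtain e where e: "e \<in> topspace (edges R)" "z = j e" using jE by blast
    have "pullback_act act0 z g = j (act1 e g)"
      using e g by (simp add: pullback_act_def source.total.orbit_act source.equivariant)
    moreover have "pullback_act act0 (?k e) g = ?k (act1 e g)"
      using e g by (simp add: pullback_act_def source.total.orbit_act range.equivariant)
    ultimately show "\<theta> (pullback_act act0 z g) = pullback_act act0 (\<theta> z) g"
      using e g by (simp add: \<theta>j source.total.act_closed)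
  qed
  let ?B = "bundle_quiver quotient_quiver (verts R) \<pi>0 \<theta>"
  interpret B: quiver_bundle G T "verts R" act0 quotient_quiver \<pi>0 \<theta>
    by unfold_locales
      (use topological_quiver_quotient principal_bundle_quotient R'(2) iso in \<open>simp_all add: quotient_quiver_def\<close>)
  \<comment> \<open>The construction sends the measure at \<open>v\<close> down to \<open>F1\<close>
    and then into the slice over \<open>v\<close>, whereas \<open>j\<close> acts in one go. Off the
    fibre of \<open>v\<close> the two maps differ, since the former always has second component
    \<open>v\<close>, but that part is null.\<close>
  have lam: "bundle_lam quotient_quiver (verts R) \<pi>0 v = distr (lam R v) (borel_of src_pullback) j"
    if v: "v \<in> topspace (verts R)" for v
  proof (rule measure_eqI)
    let ?C = "{c \<in> topspace F1. src R ` c = \<pi>0 v}"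
    have eqB: "bundle_lam quotient_quiver (verts R) \<pi>0 v = pushforward (quotient_lam (\<pi>0 v)) ?C src_pullback (\<lambda>c. (c, v))"
      using B.bundle_lam_eq[OF v] by (simp add: quotient_quiver_def)
    interpret C: radon_pushforward F1 "quotient_lam (\<pi>0 v)" ?C src_pullback "\<lambda>c. (c, v)"
      using B.radon_pushforward_fibre[OF v] by (simp add: quotient_quiver_def)
    interpret radon_pushforward "edges R" "lam R v" "fibre v" F1 \<pi>1
      by (rule radon_pushforward_orbit[OF v])
    show "sets (bundle_lam quotient_quiver (verts R) \<pi>0 v) = sets (distr (lam R v) (borel_of src_pullback) j)"
      by (simp add: eqB)
    fix A assume "A \<in> sets (bundle_lam quotient_quiver (verts R) \<pi>0 v)"
    then have A: "A \<in> sets (borel_of src_pullback)" by (simp add: eqB)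
    have mj: "j \<in> measurable (lam R v) (borel_of src_pullback)"
      by (rule continuous_map_measurable_borel_of[OF sets_M source.continuous_into_total_pullback])
    have m\<pi>: "\<pi>1 \<in> measurable (lam R v) (borel_of F1)"
      by (rule continuous_map_measurable_borel_of[OF sets_M source.total.continuous_orbit])
    have AC: "{c \<in> ?C. (c, v) \<in> A} \<in> sets (borel_of F1)"
      using C.vimage_sets[OF A] by (simp add: C.sets_M)
    \<comment> \<open>Agreement within the fibre suffices: \<open>emeasure_Int_C\<close> lets both
      preimages be intersected with it without loss of mass.\<close>
    have inter: "(\<pi>1 -` {c \<in> ?C. (c, v) \<in> A} \<inter> space (lam R v)) \<inter> fibre v = (j -` A \<inter> space (lam R v)) \<inter> fibre v"
    proof (rule Set.set_eqI)
      fix e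
      show "e \<in> (\<pi>1 -` {c \<in> ?C. (c, v) \<in> A} \<inter> space (lam R v)) \<inter> fibre v
          \<longleftrightarrow> e \<in> (j -` A \<inter> space (lam R v)) \<inter> fibre v"
      proof (cases "e \<in> fibre v")
        case True
        then have "\<pi>1 e \<in> ?C" "src R e = v"
          unfolding orbit_fibre[OF v, symmetric] by simp_all
        with True show ?thesis by simp
      next
        case False
        then show ?thesis by (simp only: Int_iff simp_thms)
      qed
    qed
    have "emeasure (bundle_lam quotient_quiver (verts R) \<pi>0 v) A = emeasure (quotient_lam (\<pi>0 v)) {c \<in> ?C. (c, v) \<in> A}"
      unfolding eqB by (rule C.emeasure_eq[OF A])
    also have "\<dots> = emeasure (lam R v) (\<pi>1 -` {c \<in> ?C. (c, v) \<in> A} \<inter> space (lam R v))"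
      unfolding quotient_lam_eq[OF v] by (rule emeasure_distr[OF m\<pi> AC])
    also have "\<dots> = emeasure (lam R v) (j -` A \<inter> space (lam R v))"
      using emeasure_Int_C[OF measurable_sets[OF m\<pi> AC]] emeasure_Int_C[OF measurable_sets[OF mj A]] inter by simp
    also have "\<dots> = emeasure (distr (lam R v) (borel_of src_pullback) j) A"
      by (rule emeasure_distr[OF mj A, symmetric])
    finally show "emeasure (bundle_lam quotient_quiver (verts R) \<pi>0 v) A
        = emeasure (distr (lam R v) (borel_of src_pullback) j) A" .
  qed
  have edges: "edges ?B = src_pullback"
    by (simp add: bundle_quiver_def quotient_quiver_def)
  have "quiver_iso R ?B j id"
    unfolding quiver_iso_def edges
    using source.homeomorphic_into_total_pullback \<theta>j lam by (simp add: bundle_quiver_def)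
  then have "isomorphic_quivers R ?B"
    unfolding isomorphic_quivers_def by (intro exI)
  with iso show thesis by (rule that)
qed

end

theorem theoremA:
  fixes G :: "'g monoid" and T :: "'g topology"
  assumes "lc_group G T" and "second_countable T"
  shows "(\<forall>(Q :: ('v, 'e) quiver) (P :: 'p topology) act q \<theta>.
            topological_quiver Q \<and>
            principal_bundle G T P act (verts Q) q \<and> second_countable P \<and>
            pullback_bundle_iso G (edges Q) P act q (src Q) (rng Q) \<theta> \<longrightarrow>
            verts (bundle_quiver Q P q \<theta>) = P \<and>
            edges (bundle_quiver Q P q \<theta>) = pullback (edges Q) (src Q) P q \<and>
            (\<forall>v \<in> topspace P. \<forall>\<phi> \<in> Cc (pullback (edges Q) (src Q) P q).
               (LINT z|lam (bundle_quiver Q P q \<theta>) v. \<phi> z) = fibre_integral Q q v \<phi>) \<and>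
            topological_quiver (bundle_quiver Q P q \<theta>) \<and>
            principal_quiver_action G T (bundle_quiver Q P q \<theta>) act (pullback_act act))
       \<and> (\<forall>(R :: ('a, 'b) quiver) act0 act1.
            topological_quiver R \<and> principal_quiver_action G T R act0 act1 \<longrightarrow>
            (\<exists>(Q :: ('a set, 'b set) quiver) (P :: 'a topology) act q \<theta>.
               topological_quiver Q \<and>
               principal_bundle G T P act (verts Q) q \<and> second_countable P \<and>
               pullback_bundle_iso G (edges Q) P act q (src Q) (rng Q) \<theta> \<and>
               isomorphic_quivers R (bundle_quiver Q P q \<theta>)))"
proof (intro conjI allI impI; elim conjE)
  fix Q :: "('v, 'e) quiver" and P :: "'p topology" and act q \<theta>
  assume "topological_quiver Q" "principal_bundle G T P act (verts Q) q" "second_countable P"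
    and "pullback_bundle_iso G (edges Q) P act q (src Q) (rng Q) \<theta>"
  then interpret quiver_bundle G T P act Q q \<theta>
    by unfold_locales (simp_all add: assms(1) principal_bundle_def)
  show "verts (bundle_quiver Q P q \<theta>) = P" "edges (bundle_quiver Q P q \<theta>) = E1"
    by (simp_all add: bundle_quiver_def)
  show "\<forall>v \<in> topspace P. \<forall>\<phi> \<in> Cc E1. (LINT z|lam (bundle_quiver Q P q \<theta>) v. \<phi> z) = fibre_integral Q q v \<phi>"
    by (simp add: bundle_quiver_def bundle_lam_integral)
  show "topological_quiver (bundle_quiver Q P q \<theta>)"
    by (rule topological_quiver_bundle_quiver)
  show "principal_quiver_action G T (bundle_quiver Q P q \<theta>) act (pullback_act act)"
    by (rule principal_quiver_action_bundle_quiver)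
next
  fix R :: "('a, 'b) quiver" and act0 act1
  assume "topological_quiver R" "principal_quiver_action G T R act0 act1"
  then interpret principal_quiver G T R act0 act1
    by unfold_locales (simp_all add: assms(1))
  obtain \<theta> where "pullback_bundle_iso G F1 (verts R) act0 \<pi>0 ((`) (src R)) ((`) (rng R)) \<theta>"
    "isomorphic_quivers R (bundle_quiver quotient_quiver (verts R) \<pi>0 \<theta>)"
    by (rule isomorphic_bundle_quiver) (rule that)
  then show "\<exists>(Q :: ('a set, 'b set) quiver) (P :: 'a topology) act q \<theta>.
      topological_quiver Q \<and>
      principal_bundle G T P act (verts Q) q \<and> second_countable P \<and>
      pullback_bundle_iso G (edges Q) P act q (src Q) (rng Q) \<theta> \<and>
      isomorphic_quivers R (bundle_quiver Q P q \<theta>)"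
    using topological_quiver_quotient principal_bundle_quotient R'(2)
    by (intro exI[of _ quotient_quiver] exI[of _ "verts R"] exI[of _ act0] exI[of _ \<pi>0] exI[of _ \<theta>])
      (simp add: quotient_quiver_def)
qed

end
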